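(* Let $X$ be a finite metric space, $a_0\in X$, and $P\subseteq\mathcal{P}_X$ with $P=P^{-1}$ and $X\setminus\{a_0\}\subseteq P(a_0)$. For a pair $(Y,\phi)$ the following are equivalent: (i) $(Y,\phi)$ is a finite minimal $P$-type S-extension of $X$; (ii) there exists a normal subgroup $N$ of $\mathbb{F}(P)$ of finite index satisfying (C1), (C2), (C3), and, letting $G=\Phi_N(\mathbb{F}(P))$, there exists a $G$-invariant pseudometric $\rho$ on $\Gamma_N$ consistent with $w_N$ such that $(Y,\phi)$ is isomorphic to $(\overline{\Gamma_N},\overline{\Phi_N})$; (iii) for $N=\ker(\phi)$ and $G=\Phi_N(\mathbb{F}(P))$, there exists a $G$-invariant pseudometric $\rho$ on $\Gamma_N$ consistent with $w_N$ such that $(Y,\phi)$ is isomorphic to $(\overline{\Gamma_N},\overline{\Phi_N})$.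
   Context: A partial isometry of $X$ is an isometry between finite subsets of $X$; $\mathcal{P}_X$ is the set of those not contained in the identity; $P(a_0)=\{p(a_0):p\in P,\ a_0\in\mathrm{dom}(p)\}$. A $P$-type S-extension of $X$ is $(Y,\phi)$ with $Y$ a metric space extending $X$ and $\phi:P\to\mathrm{Iso}(Y)$, $\phi(p)\restriction\mathrm{dom}(p)=p$; with $\phi(p^{-1})=\phi(p)^{-1}$ assumed, $\phi$ is extended to a homomorphism $\mathbb{F}(P)\to\mathrm{Iso}(Y)$, $\mathbb{F}(P)$ the free group on $P$ with $p^{-1}\in P$ identified with the formal inverse of $p$; $\ker(\phi)$ refers to this homomorphism. Minimal: every $y\in Y$ is $\phi(g)(a_0)$ for some $g$. Two $P$-type S-extensions $(Y,\phi),(Z,\psi)$ are isomorphic if there is an isometry $\pi:Y\to Z$ with $\psi(p)\circ\pi=\pi\circ\phi(p)$ for all $p\in P$. Let $H\le\mathbb{F}(P)$ be the subgroup of elements represented by words $p_1\cdots p_n$ ($p_i\in P$) such that $p_1(p_2(\cdots p_n(a_0)\cdots))$ is defined and equals $a_0$. For $N\trianglelefteq\mathbb{F}(P)$ consider the conditions (all $p,q,r,s,r_i,s_i\in P\cup\{1\}$ are assumed defined at $a_0$): (C1) if $d_X(p(a_0),q(a_0))\ne d_X(r(a_0),s(a_0))$ then $N\cap pHr^{-1}sHq^{-1}=\emptyset$; (C2) if $p(a_0)\neq q(a_0)$ then $N\cap pHq^{-1}=\emptyset$; (C3) if $d_X(p(a_0),q(a_0))>\sum_{i=1}^n d_X(r_i(a_0),s_i(a_0))$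 then $N\cap pHr_1^{-1}s_1H\cdots Hr_n^{-1}s_nHq^{-1}=\emptyset$. Let $\Gamma_N=\{gNH: g\in\mathbb{F}(P)\}$ (left cosets of the subgroup $NH$). The weighted graph $(\Gamma_N,w_N)$ has an edge between $gpNH$ and $gqNH$ whenever $g\in\mathbb{F}(P)$, $p,q\in P\cup\{1\}$ with $p(a_0),q(a_0)$ defined and these cosets distinct, with weight $w_N=d_X(p(a_0),q(a_0))$ (well defined under (C1)). $\Phi_N:\mathbb{F}(P)\to\mathrm{Sym}(\Gamma_N)$ is the homomorphism $\Phi_N(g)(hNH)=ghNH$. A pseudometric $\rho$ on $\Gamma_N$ is consistent with $w_N$ if $\rho(x,y)=w_N(x,y)$ on every edge, and $G$-invariant if every element of $G$ preserves $\rho$. $(\overline{\Gamma_N},\overline\rho)$ is the metric identification ($x\sim y$ iff $\rho(x,y)=0$) and $\overline{\Phi_N}(p)([x])=[\Phi_N(p)(x)]$; $X$ is regarded as a subset of $\overline{\Gamma_N}$ via $a_0\mapsto[NH]$, $a\mapsto[pNH]$ for any $p\in P$ with $p(a_0)=a$. (For any $P$-type S-extension, $\ker\phi$ satisfies (C1)–(C3), so these objects are defined in (iii).)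
   Formalization: In (iii) it is added that ker(φ) has finite index and satisfies (C1)–(C3); otherwise Y could be infinite or a single point. In (i), Y extends X through some isometric embedding of X into Y rather than a fixed inclusion, since isomorphisms need not respect X. *)

theory Defs
  imports "HOL-Analysis.Abstract_Metric_Spaces" "HOL-Algebra.Bij" "HOL-Algebra.Left_Coset"
begin

section \<open>Partial isometries\<close>

text \<open>
  A partial isometry is represented by its graph, so \<open>p\<^sup>-\<^sup>1\<close> is the converse relation,
  \<open>dom(p)\<close> is \<^term>\<open>Domain p\<close>, and \<open>p(a) = b\<close> reads \<^term>\<open>(a, b) \<in> p\<close>. The isometry
  equation makes the graph single-valued and injective whenever \<open>d\<close> is a metric on \<open>X\<close>.
\<close>

type_synonym 'a pmap = "('a \<times> 'a) set"

definition partial_isometry :: "'a set \<Rightarrow> ('a \<Rightarrow> 'a \<Rightarrow> real) \<Rightarrow> 'a pmap \<Rightarrow> bool" where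
  "partial_isometry X d p \<longleftrightarrow> finite p \<and> p \<subseteq> X \<times> X \<and>
     (\<forall>(x, x') \<in> p. \<forall>(y, y') \<in> p. d x' y' = d x y)"

definition nontrivial_partial_isometries :: "'a set \<Rightarrow> ('a \<Rightarrow> 'a \<Rightarrow> real) \<Rightarrow> 'a pmap set" where
  "nontrivial_partial_isometries X d = {p. partial_isometry X d p \<and> \<not> p \<subseteq> Id}"

definition values_at :: "'a pmap set \<Rightarrow> 'a \<Rightarrow> 'a set" where
  "values_at P a0 = {a. \<exists>p\<in>P. (a0, a) \<in> p}"

section \<open>The group \<open>\<F>(P)\<close>\<close>

text \<open>
  Elements are words over \<open>P\<close> modulo insertion and deletion of factors \<open>p p\<^sup>-\<^sup>1\<close>, where
  \<open>p\<^sup>-\<^sup>1\<close> is again a letter in \<open>P\<close> (\<open>P = P\<^sup>-\<^sup>1\<close> is assumed wherever this is used). If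
  \<open>p = p\<^sup>-\<^sup>1\<close> as partial isometries, the identification with the formal inverse forces
  \<open>p\<close> to have order two.
\<close>

definition cancel_step :: "'a pmap set \<Rightarrow> ('a pmap list \<times> 'a pmap list) set" where
  "cancel_step P = {(u @ [p, converse p] @ v, u @ v) | u v p. u \<in> lists P \<and> v \<in> lists P \<and> p \<in> P}"

definition word_equiv :: "'a pmap set \<Rightarrow> ('a pmap list \<times> 'a pmap list) set" where
  "word_equiv P = (cancel_step P \<union> (cancel_step P)\<inverse>)\<^sup>*"

definition word_class :: "'a pmap set \<Rightarrow> 'a pmap list \<Rightarrow> 'a pmap list set" where
  "word_class P w = word_equiv P `` {w}"

definition free_group :: "'a pmap set \<Rightarrow> 'a pmap list set monoid" (\<open>\<F>\<close>) where
  "\<F> P = \<lparr>carrier = word_class P ` lists P,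
          mult = (\<lambda>A B. word_equiv P `` {u @ v | u v. u \<in> A \<and> v \<in> B}),
          one = word_class P []\<rparr>"

text \<open>
  The extension of a map \<open>\<phi>\<close> from \<open>P\<close> to a group \<open>K\<close> to \<open>\<F> P\<close>. The value does not depend
  on the representing word when \<open>\<phi>(p\<^sup>-\<^sup>1) = \<phi>(p)\<^sup>-\<^sup>1\<close> for all \<open>p\<close>.
\<close>

definition hom_extension ::
    "('g, 'm) monoid_scheme \<Rightarrow> ('a pmap \<Rightarrow> 'g) \<Rightarrow> 'a pmap list set \<Rightarrow> 'g" where
  "hom_extension K \<phi> g =
     (THE k. \<forall>w\<in>g. k = foldr (\<lambda>p x. \<phi> p \<otimes>\<^bsub>K\<^esub> x) w \<one>\<^bsub>K\<^esub>)"

text \<open>\<open>word_map [p\<^sub>1, \<dots>, p\<^sub>n]\<close> is the graph of the partial map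
  \<open>p\<^sub>1 \<circ> \<dots> \<circ> p\<^sub>n\<close>; \<open>p\<^sub>n\<close> is applied first.\<close>

primrec word_map :: "'a pmap list \<Rightarrow> 'a pmap" where
  "word_map [] = Id"
| "word_map (p # w) = word_map w O p"

definition H_subgroup :: "'a pmap set \<Rightarrow> 'a \<Rightarrow> 'a pmap list set set" where
  "H_subgroup P a0 = {word_class P w | w. w \<in> lists P \<and> (a0, a0) \<in> word_map w}"

section \<open>The conditions on \<open>N\<close>\<close>

text \<open>The elements of \<open>P \<union> {1}\<close>, viewed in \<open>\<F> P\<close>, that are defined at \<open>a0\<close> and send it to
  \<open>a\<close>.\<close>

definition letters_to :: "'a pmap set \<Rightarrow> 'a \<Rightarrow> 'a \<Rightarrow> 'a pmap list set set" where
  "letters_to P a0 a =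
     {word_class P [p] | p. p \<in> P \<and> (a0, a) \<in> p} \<union> (if a = a0 then {\<one>\<^bsub>\<F> P\<^esub>} else {})"

definition cond_C1 ::
    "('a \<Rightarrow> 'a \<Rightarrow> real) \<Rightarrow> 'a \<Rightarrow> 'a pmap set \<Rightarrow> 'a pmap list set set \<Rightarrow> bool" where
  "cond_C1 d a0 P N \<longleftrightarrow>
     (\<forall>a b c e. \<forall>p\<in>letters_to P a0 a. \<forall>q\<in>letters_to P a0 b.
        \<forall>r\<in>letters_to P a0 c. \<forall>s\<in>letters_to P a0 e.
          d a b \<noteq> d c e \<longrightarrow>
          N \<inter> ({p} <#>\<^bsub>\<F> P\<^esub> H_subgroup P a0
               <#>\<^bsub>\<F> P\<^esub> {inv\<^bsub>\<F> P\<^esub> r \<otimes>\<^bsub>\<F> P\<^esub> s} <#>\<^bsub>\<F> P\<^esub> H_subgroup P a0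
               <#>\<^bsub>\<F> P\<^esub> {inv\<^bsub>\<F> P\<^esub> q}) = {})"

definition cond_C2 :: "'a \<Rightarrow> 'a pmap set \<Rightarrow> 'a pmap list set set \<Rightarrow> bool" where
  "cond_C2 a0 P N \<longleftrightarrow>
     (\<forall>a b. \<forall>p\<in>letters_to P a0 a. \<forall>q\<in>letters_to P a0 b.
        a \<noteq> b \<longrightarrow>
        N \<inter> ({p} <#>\<^bsub>\<F> P\<^esub> H_subgroup P a0 <#>\<^bsub>\<F> P\<^esub> {inv\<^bsub>\<F> P\<^esub> q}) = {})"

text \<open>\<open>chain P H [(r\<^sub>1, s\<^sub>1), \<dots>, (r\<^sub>n, s\<^sub>n)]\<close> is
  \<open>H r\<^sub>1\<^sup>-\<^sup>1 s\<^sub>1 H \<dots> H r\<^sub>n\<^sup>-\<^sup>1 s\<^sub>n H\<close>.\<close>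

primrec chain :: "'a pmap set \<Rightarrow> 'a pmap list set set \<Rightarrow>
    ('a pmap list set \<times> 'a pmap list set) list \<Rightarrow> 'a pmap list set set" where
  "chain P H [] = H"
| "chain P H (rs # rss) =
     H <#>\<^bsub>\<F> P\<^esub> {inv\<^bsub>\<F> P\<^esub> (fst rs) \<otimes>\<^bsub>\<F> P\<^esub> snd rs} <#>\<^bsub>\<F> P\<^esub> chain P H rss"

definition cond_C3 ::
    "('a \<Rightarrow> 'a \<Rightarrow> real) \<Rightarrow> 'a \<Rightarrow> 'a pmap set \<Rightarrow> 'a pmap list set set \<Rightarrow> bool" where
  "cond_C3 d a0 P N \<longleftrightarrow>
     (\<forall>(n::nat) a b c e r s. \<forall>p\<in>letters_to P a0 a. \<forall>q\<in>letters_to P a0 b.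
        1 \<le> n \<longrightarrow>
        (\<forall>i\<in>{1..n}. r i \<in> letters_to P a0 (c i) \<and> s i \<in> letters_to P a0 (e i)) \<longrightarrow>
        d a b > (\<Sum>i=1..n. d (c i) (e i)) \<longrightarrow>
        N \<inter> ({p} <#>\<^bsub>\<F> P\<^esub>
               chain P (H_subgroup P a0) (map (\<lambda>i. (r i, s i)) [1..<Suc n])
               <#>\<^bsub>\<F> P\<^esub> {inv\<^bsub>\<F> P\<^esub> q}) = {})"

section \<open>The weighted graph \<open>\<Gamma>\<^sub>N\<close>\<close>

definition NH :: "'a \<Rightarrow> 'a pmap set \<Rightarrow> 'a pmap list set set \<Rightarrow> 'a pmap list set set" where
  "NH a0 P N = N <#>\<^bsub>\<F> P\<^esub> H_subgroup P a0"

definition Gam :: "'a \<Rightarrow> 'a pmap set \<Rightarrow> 'a pmap list set set \<Rightarrow> 'a pmap list set set set" where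
  "Gam a0 P N = lcosets\<^bsub>\<F> P\<^esub> (NH a0 P N)"

definition edge_with_weight :: "('a \<Rightarrow> 'a \<Rightarrow> real) \<Rightarrow> 'a \<Rightarrow> 'a pmap set \<Rightarrow>
    'a pmap list set set \<Rightarrow> 'a pmap list set set \<Rightarrow> 'a pmap list set set \<Rightarrow> real \<Rightarrow> bool" where
  "edge_with_weight d a0 P N x y t \<longleftrightarrow>
     (\<exists>g\<in>carrier (\<F> P). \<exists>a b. \<exists>p\<in>letters_to P a0 a. \<exists>q\<in>letters_to P a0 b.
        x = (g \<otimes>\<^bsub>\<F> P\<^esub> p) <#\<^bsub>\<F> P\<^esub> NH a0 P N \<and>
        y = (g \<otimes>\<^bsub>\<F> P\<^esub> q) <#\<^bsub>\<F> P\<^esub> NH a0 P N \<and>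
        x \<noteq> y \<and> t = d a b)"

definition is_edge :: "('a \<Rightarrow> 'a \<Rightarrow> real) \<Rightarrow> 'a \<Rightarrow> 'a pmap set \<Rightarrow>
    'a pmap list set set \<Rightarrow> 'a pmap list set set \<Rightarrow> 'a pmap list set set \<Rightarrow> bool" where
  "is_edge d a0 P N x y \<longleftrightarrow> (\<exists>t. edge_with_weight d a0 P N x y t)"

text \<open>Meaningful on edges, where (C1) makes the weight unique.\<close>

definition weight :: "('a \<Rightarrow> 'a \<Rightarrow> real) \<Rightarrow> 'a \<Rightarrow> 'a pmap set \<Rightarrow>
    'a pmap list set set \<Rightarrow> 'a pmap list set set \<Rightarrow> 'a pmap list set set \<Rightarrow> real" where
  "weight d a0 P N x y = (THE t. edge_with_weight d a0 P N x y t)"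

definition Phi :: "'a \<Rightarrow> 'a pmap set \<Rightarrow> 'a pmap list set set \<Rightarrow> 'a pmap list set \<Rightarrow>
    'a pmap list set set \<Rightarrow> 'a pmap list set set" where
  "Phi a0 P N g = (\<lambda>x\<in>Gam a0 P N. g <#\<^bsub>\<F> P\<^esub> x)"

section \<open>Pseudometrics and metric identification\<close>

definition pseudometric :: "'v set \<Rightarrow> ('v \<Rightarrow> 'v \<Rightarrow> real) \<Rightarrow> bool" where
  "pseudometric V \<rho> \<longleftrightarrow>
     (\<forall>x\<in>V. \<rho> x x = 0) \<and> (\<forall>x\<in>V. \<forall>y\<in>V. 0 \<le> \<rho> x y \<and> \<rho> x y = \<rho> y x) \<and>
     (\<forall>x\<in>V. \<forall>y\<in>V. \<forall>z\<in>V. \<rho> x z \<le> \<rho> x y + \<rho> y z)"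

definition invariant_under :: "('v \<Rightarrow> 'v) set \<Rightarrow> 'v set \<Rightarrow> ('v \<Rightarrow> 'v \<Rightarrow> real) \<Rightarrow> bool" where
  "invariant_under G V \<rho> \<longleftrightarrow> (\<forall>f\<in>G. \<forall>x\<in>V. \<forall>y\<in>V. \<rho> (f x) (f y) = \<rho> x y)"

definition consistent_with_weight :: "('a \<Rightarrow> 'a \<Rightarrow> real) \<Rightarrow> 'a \<Rightarrow> 'a pmap set \<Rightarrow>
    'a pmap list set set \<Rightarrow> ('a pmap list set set \<Rightarrow> 'a pmap list set set \<Rightarrow> real) \<Rightarrow> bool" where
  "consistent_with_weight d a0 P N \<rho> \<longleftrightarrow>
     (\<forall>x y. is_edge d a0 P N x y \<longrightarrow> \<rho> x y = weight d a0 P N x y)"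

definition zero_dist :: "'v set \<Rightarrow> ('v \<Rightarrow> 'v \<Rightarrow> real) \<Rightarrow> ('v \<times> 'v) set" where
  "zero_dist V \<rho> = {(x, y). x \<in> V \<and> y \<in> V \<and> \<rho> x y = 0}"

definition metric_ident :: "'v set \<Rightarrow> ('v \<Rightarrow> 'v \<Rightarrow> real) \<Rightarrow> 'v set set" where
  "metric_ident V \<rho> = V // zero_dist V \<rho>"

definition ident_dist :: "('v \<Rightarrow> 'v \<Rightarrow> real) \<Rightarrow> 'v set \<Rightarrow> 'v set \<Rightarrow> real" where
  "ident_dist \<rho> A B = (THE t. \<forall>x\<in>A. \<forall>y\<in>B. \<rho> x y = t)"

text \<open>The map \<open>[x] \<mapsto> [f x]\<close>; for \<open>\<rho>\<close>-preserving \<open>f\<close> the right-hand side is a single class.\<close>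

definition ident_map :: "'v set \<Rightarrow> ('v \<Rightarrow> 'v \<Rightarrow> real) \<Rightarrow> ('v \<Rightarrow> 'v) \<Rightarrow> 'v set \<Rightarrow> 'v set" where
  "ident_map V \<rho> f = (\<lambda>A\<in>metric_ident V \<rho>. zero_dist V \<rho> `` (f ` A))"

definition Phi_bar :: "'a \<Rightarrow> 'a pmap set \<Rightarrow> 'a pmap list set set \<Rightarrow>
    ('a pmap list set set \<Rightarrow> 'a pmap list set set \<Rightarrow> real) \<Rightarrow>
    'a pmap \<Rightarrow> 'a pmap list set set set \<Rightarrow> 'a pmap list set set set" where
  "Phi_bar a0 P N \<rho> p = ident_map (Gam a0 P N) \<rho> (Phi a0 P N (word_class P [p]))"

section \<open>S-extensions\<close>

definition iso_group :: "'b set \<Rightarrow> ('b \<Rightarrow> 'b \<Rightarrow> real) \<Rightarrow> ('b \<Rightarrow> 'b) monoid" where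
  "iso_group Y e =
     BijGroup Y \<lparr>carrier := {f \<in> Bij Y. \<forall>x\<in>Y. \<forall>y\<in>Y. e (f x) (f y) = e x y}\<rparr>"

text \<open>
  Data \<open>(Y, \<phi>)\<close> for which \<open>ker \<phi>\<close> and isomorphisms make sense, before any relation to
  \<open>X\<close> is imposed.
\<close>

definition isometry_pair ::
    "'a pmap set \<Rightarrow> 'b set \<Rightarrow> ('b \<Rightarrow> 'b \<Rightarrow> real) \<Rightarrow> ('a pmap \<Rightarrow> 'b \<Rightarrow> 'b) \<Rightarrow> bool" where
  "isometry_pair P Y e \<phi> \<longleftrightarrow>
     Metric_space Y e \<and> \<phi> \<in> P \<rightarrow> carrier (iso_group Y e) \<and>
     (\<forall>p\<in>P. \<phi> (converse p) = inv\<^bsub>iso_group Y e\<^esub> (\<phi> p))"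

text \<open>
  \<open>Y\<close> extends \<open>X\<close> through the isometric embedding \<open>\<iota>\<close>. For the metric identification of
  \<open>\<Gamma>\<^sub>N\<close> this is \<open>a0 \<mapsto> [NH]\<close>, \<open>a \<mapsto> [pNH]\<close> with \<open>p(a0) = a\<close>. Isomorphisms of pairs
  are not required to respect chosen embeddings, so being an S-extension is invariant under
  isomorphism only with \<open>\<iota>\<close> existentially quantified.
\<close>

definition S_extension :: "'a set \<Rightarrow> ('a \<Rightarrow> 'a \<Rightarrow> real) \<Rightarrow> 'a pmap set \<Rightarrow>
    'b set \<Rightarrow> ('b \<Rightarrow> 'b \<Rightarrow> real) \<Rightarrow> ('a pmap \<Rightarrow> 'b \<Rightarrow> 'b) \<Rightarrow> ('a \<Rightarrow> 'b) \<Rightarrow> bool" where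
  "S_extension X d P Y e \<phi> \<iota> \<longleftrightarrow>
     isometry_pair P Y e \<phi> \<and>
     \<iota> \<in> X \<rightarrow> Y \<and> (\<forall>x\<in>X. \<forall>y\<in>X. e (\<iota> x) (\<iota> y) = d x y) \<and>
     (\<forall>p\<in>P. \<forall>(x, y)\<in>p. \<phi> p (\<iota> x) = \<iota> y)"

definition minimal_extension :: "'a \<Rightarrow> 'a pmap set \<Rightarrow>
    'b set \<Rightarrow> ('b \<Rightarrow> 'b \<Rightarrow> real) \<Rightarrow> ('a pmap \<Rightarrow> 'b \<Rightarrow> 'b) \<Rightarrow> ('a \<Rightarrow> 'b) \<Rightarrow> bool" where
  "minimal_extension a0 P Y e \<phi> \<iota> \<longleftrightarrow>
     (\<forall>y\<in>Y. \<exists>g\<in>carrier (\<F> P). y = hom_extension (iso_group Y e) \<phi> g (\<iota> a0))"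

definition isomorphic_pairs :: "'a pmap set \<Rightarrow>
    'b set \<Rightarrow> ('b \<Rightarrow> 'b \<Rightarrow> real) \<Rightarrow> ('a pmap \<Rightarrow> 'b \<Rightarrow> 'b) \<Rightarrow>
    'c set \<Rightarrow> ('c \<Rightarrow> 'c \<Rightarrow> real) \<Rightarrow> ('a pmap \<Rightarrow> 'c \<Rightarrow> 'c) \<Rightarrow> bool" where
  "isomorphic_pairs P Y e \<phi> Z f \<psi> \<longleftrightarrow>
     (\<exists>\<pi>. bij_betw \<pi> Y Z \<and> (\<forall>x\<in>Y. \<forall>y\<in>Y. f (\<pi> x) (\<pi> y) = e x y) \<and>
          (\<forall>p\<in>P. \<forall>y\<in>Y. \<psi> p (\<pi> y) = \<pi> (\<phi> p y)))"

end

theory Submission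
  imports Defs "HOL-Algebra.Zassenhaus"
begin

text \<open>
  An S-extension \<open>(Y, \<phi>)\<close> is recovered from the orbit of the base point: \<open>H\<close> fixes \<open>a\<^sub>0\<close> in every
  S-extension, so \<open>gNH \<mapsto> \<phi>(g)(a\<^sub>0)\<close> is well defined on \<open>\<Gamma>\<^sub>N\<close> for \<open>N = ker \<phi>\<close>, it is onto \<open>Y\<close> by
  minimality, and pulling the metric of \<open>Y\<close> back along it gives the pseudometric of (iii). The
  conditions (C1)--(C3) express that \<open>\<phi>\<close> acts by isometries, that \<open>X\<close> embeds injectively, and the
  triangle inequality. Since a kernel is normal, (iii) implies (ii). Given (ii), the vertices
  \<open>pNH\<close> with \<open>p(a\<^sub>0) = a\<close> all agree; (C1) makes the weights unique and (C2) makes distinct points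
  of \<open>X\<close> give distinct vertices, so consistency of \<open>\<rho>\<close> says that \<open>a \<mapsto> [pNH]\<close> is isometric, and
  this embedding is transported to \<open>Y\<close>.
\<close>

declare in_lists_conv_set [simp] ball_Un [simp]

section \<open>The word group\<close>

lemma sym_word_equiv: "sym (word_equiv P)"
  by (simp add: word_equiv_def sym_Un_converse sym_rtrancl)

lemma trans_word_equiv: "trans (word_equiv P)"
  by (simp add: word_equiv_def trans_rtrancl)

lemma word_equiv_refl [simp]: "(w, w) \<in> word_equiv P"
  by (simp add: word_equiv_def)

lemma word_class_eq_iff: "word_class P u = word_class P v \<longleftrightarrow> (u, v) \<in> word_equiv P"
proof
  assume "word_class P u = word_class P v"
  then have "v \<in> word_class P u" by (simp add: word_class_def)
  then show "(u, v) \<in> word_equiv P" by (simp add: word_class_def)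
next
  assume "(u, v) \<in> word_equiv P"
  then show "word_class P u = word_class P v"
    unfolding word_class_def
    by (auto dest: symD[OF sym_word_equiv] transD[OF trans_word_equiv])
qed

text \<open>Equality is symmetric, so invariance under deleting one pair also covers insertion, and
  the closure follows by induction. Its two uses are membership in \<open>lists P\<close> and
  evaluation in a group.\<close>

lemma word_equiv_invariant:
  assumes "\<And>u v p. \<lbrakk>u \<in> lists P; v \<in> lists P; p \<in> P\<rbrakk> \<Longrightarrow> f (u @ p # converse p # v) = f (u @ v)"
    and "(u, v) \<in> word_equiv P"
  shows "f u = f v"
  using assms(2) unfolding word_equiv_def
  by (induction rule: rtrancl_induct) (auto simp: cancel_step_def assms(1))

text \<open>A deletion inside a word remains a deletion after padding on both sides. Since
  \<open>cancel_step P\<close> relates only words over \<open>P\<close>, the padding has to be over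
  \<open>P\<close> too.\<close>

lemma word_equiv_append:
  assumes "x \<in> lists P" "y \<in> lists P" "(u, v) \<in> word_equiv P"
  shows "(x @ u @ y, x @ v @ y) \<in> word_equiv P"
proof -
  have context_step: "(x @ s @ y, x @ t @ y) \<in> cancel_step P" if "(s, t) \<in> cancel_step P" for s t
  proof -
    from that obtain u v p where "s = u @ [p, converse p] @ v" "t = u @ v"
      "u \<in> lists P" "v \<in> lists P" "p \<in> P"
      unfolding cancel_step_def by blast
    then have "(x @ s @ y, x @ t @ y) = ((x @ u) @ [p, converse p] @ (v @ y), (x @ u) @ (v @ y))"
      "x @ u \<in> lists P" "v @ y \<in> lists P"
      using assms(1,2) by auto
    with \<open>p \<in> P\<close> show ?thesis unfolding cancel_step_def by blast
  qed
  show ?thesis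
    using assms(3) unfolding word_equiv_def
  proof (induction rule: rtrancl_induct)
    case (step s t)
    then have "(x @ s @ y, x @ t @ y) \<in> cancel_step P \<union> (cancel_step P)\<inverse>"
      using context_step by blast
    with step.IH show ?case by (rule rtrancl_into_rtrancl)
  qed simp
qed

locale converse_closed =
  fixes P :: "'a pmap set"
  assumes converse_image: "converse ` P = P"
begin

lemma converse_mem [simp]: "p \<in> P \<Longrightarrow> converse p \<in> P"
  using converse_image by blast

text \<open>\<open>word_equiv P\<close> is reflexive on all lists, so it also has classes of lists
  that are not words over \<open>P\<close>; this keeps them apart from the elements of
  \<open>\<F> P\<close>.\<close>

lemma word_equiv_lists: "(u, v) \<in> word_equiv P \<Longrightarrow> u \<in> lists P \<longleftrightarrow> v \<in> lists P"
  by (rule word_equiv_invariant[where P = P]) auto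

definition word_inverse :: "'a pmap list \<Rightarrow> 'a pmap list" where
  "word_inverse w = rev (map converse w)"

lemma set_word_inverse [simp]: "set (word_inverse w) = converse ` set w"
  by (simp add: word_inverse_def)

lemma word_inverse_inverse [simp]: "word_inverse (word_inverse w) = w"
  by (simp add: word_inverse_def rev_map comp_def)

lemma word_class_mult [simp]:
  assumes "u \<in> lists P" "v \<in> lists P"
  shows "word_class P u \<otimes>\<^bsub>\<F> P\<^esub> word_class P v = word_class P (u @ v)"
proof -
  have "(u @ v, u' @ v') \<in> word_equiv P"
    if "(u, u') \<in> word_equiv P" "(v, v') \<in> word_equiv P" for u' v'
  proof -
    have "(u @ v, u' @ v) \<in> word_equiv P"
      using word_equiv_append[OF _ assms(2) that(1), of "[]"] by simp
    moreover have "(u' @ v, u' @ v') \<in> word_equiv P"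
      using word_equiv_append[OF _ _ that(2), of u' "[]"] word_equiv_lists[OF that(1)] assms by simp
    ultimately show ?thesis by (rule transD[OF trans_word_equiv])
  qed
  then have *: "word_class P (u' @ v') = word_class P (u @ v)"
    if "u' \<in> word_class P u" "v' \<in> word_class P v" for u' v'
    using that by (metis word_class_def Image_singleton_iff word_class_eq_iff)
  have "u \<in> word_class P u" "v \<in> word_class P v" by (simp_all add: word_class_def)
  \<comment> \<open>The product in \<open>free_group\<close> is the saturation of a set of
    concatenations, hence a union of classes. All of them coincide by \<open>*\<close>, and there is
    at least one.\<close>
  moreover have "word_class P u \<otimes>\<^bsub>\<F> P\<^esub> word_class P v
      = (\<Union>u'\<in>word_class P u. \<Union>v'\<in>word_class P v. word_class P (u' @ v'))"
    unfolding free_group_def by (auto simp: word_class_def)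
  ultimately show ?thesis using * by blast
qed

lemma one_free_group: "\<one>\<^bsub>\<F> P\<^esub> = word_class P []"
  by (simp add: free_group_def)

lemma carrier_free_group: "carrier (\<F> P) = word_class P ` lists P"
  by (simp add: free_group_def)

lemma word_class_carrier [simp]: "w \<in> lists P \<Longrightarrow> word_class P w \<in> carrier (\<F> P)"
  by (simp add: carrier_free_group)

lemma carrier_free_groupE:
  assumes "x \<in> carrier (\<F> P)"
  obtains w where "w \<in> lists P" "x = word_class P w"
  using assms by (auto simp: carrier_free_group)

text \<open>In \<open>w p p^-1 w^-1\<close> the innermost pair cancels, so the induction removes the
  last letter, not the first.\<close>

lemma word_class_inverse:
  assumes "w \<in> lists P"
  shows "word_class P (w @ word_inverse w) = word_class P []"
  using assms
proof (induction w rule: rev_induct)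
  case (snoc p w)
  then have w: "w \<in> lists P" "word_inverse w \<in> lists P" "p \<in> P" by auto
  have "(w @ [p, converse p] @ word_inverse w, w @ word_inverse w) \<in> cancel_step P"
    using w unfolding cancel_step_def by blast
  then have "(w @ [p, converse p] @ word_inverse w, w @ word_inverse w) \<in> word_equiv P"
    by (auto simp: word_equiv_def)
  with snoc w show ?case
    by (simp add: word_inverse_def flip: word_class_eq_iff)
qed (simp add: word_inverse_def)

lemma group_free_group: "group (\<F> P)"
proof (rule groupI)
  fix x y assume "x \<in> carrier (\<F> P)" "y \<in> carrier (\<F> P)"
  then show "x \<otimes>\<^bsub>\<F> P\<^esub> y \<in> carrier (\<F> P)"
    by (elim carrier_free_groupE) simp
next
  fix x y z assume "x \<in> carrier (\<F> P)" "y \<in> carrier (\<F> P)" "z \<in> carrier (\<F> P)"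
  then show "x \<otimes>\<^bsub>\<F> P\<^esub> y \<otimes>\<^bsub>\<F> P\<^esub> z = x \<otimes>\<^bsub>\<F> P\<^esub> (y \<otimes>\<^bsub>\<F> P\<^esub> z)"
    by (elim carrier_free_groupE) simp
next
  fix x assume "x \<in> carrier (\<F> P)"
  then obtain w where w: "w \<in> lists P" "x = word_class P w" by (rule carrier_free_groupE)
  then show "\<one>\<^bsub>\<F> P\<^esub> \<otimes>\<^bsub>\<F> P\<^esub> x = x"
    by (simp add: one_free_group)
  \<comment> \<open>\<open>groupI\<close> asks for a left inverse while
    \<open>word_class_inverse\<close> gives a right one; it is applied to the inverse word, whose
    own inverse is \<open>w\<close>.\<close>
  show "\<exists>y\<in>carrier (\<F> P). y \<otimes>\<^bsub>\<F> P\<^esub> x = \<one>\<^bsub>\<F> P\<^esub>"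
    using w word_class_inverse[of "word_inverse w"]
    by (intro bexI[of _ "word_class P (word_inverse w)"]) (auto simp: one_free_group)
qed (simp add: one_free_group)

sublocale F: group "\<F> P"
  by (rule group_free_group)

lemma inv_word_class: "w \<in> lists P \<Longrightarrow> inv\<^bsub>\<F> P\<^esub> (word_class P w) = word_class P (word_inverse w)"
  by (rule F.inv_equality)
    (use word_class_inverse[of "word_inverse w"] in \<open>auto simp: one_free_group\<close>)

section \<open>Partial maps of words and the subgroup of words fixing the base point\<close>

lemma word_map_append [simp]: "word_map (u @ v) = word_map v O word_map u"
  by (induction u) auto

lemma word_map_inverse: "word_map (word_inverse w) = converse (word_map w)"
  by (induction w) (auto simp: word_inverse_def)

text \<open>The word \<open>v\<close> carries \<open>a0\<close> to \<open>a\<close>, and the inverse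
  of \<open>u\<close> carries \<open>a\<close> back to \<open>a0\<close>.\<close>

lemma inv_mult_mem_H_subgroup:
  assumes "u \<in> lists P" "v \<in> lists P" "(a0, a) \<in> word_map u" "(a0, a) \<in> word_map v"
  shows "inv\<^bsub>\<F> P\<^esub> (word_class P u) \<otimes>\<^bsub>\<F> P\<^esub> word_class P v \<in> H_subgroup P a0"
proof -
  have "(a0, a0) \<in> word_map (word_inverse u @ v)"
    using assms by (auto simp: word_map_inverse)
  with assms show ?thesis
    unfolding H_subgroup_def
    by (intro CollectI exI[of _ "word_inverse u @ v"]) (auto simp: inv_word_class)
qed

lemma subgroup_H_subgroup: "subgroup (H_subgroup P a0) (\<F> P)"
proof (rule subgroup.intro)
  show "\<one>\<^bsub>\<F> P\<^esub> \<in> H_subgroup P a0"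
    unfolding H_subgroup_def one_free_group by (rule CollectI, rule exI[of _ "[]"]) simp
next
  fix x y assume "x \<in> H_subgroup P a0" "y \<in> H_subgroup P a0"
  then obtain u v where "u \<in> lists P" "v \<in> lists P" "x = word_class P u" "y = word_class P v"
    "(a0, a0) \<in> word_map (u @ v)"
    by (auto simp: H_subgroup_def)
  then show "x \<otimes>\<^bsub>\<F> P\<^esub> y \<in> H_subgroup P a0"
    unfolding H_subgroup_def by (intro CollectI exI[of _ "u @ v"]) auto
next
  fix x assume "x \<in> H_subgroup P a0"
  then obtain u where "u \<in> lists P" "x = word_class P u" "(a0, a0) \<in> word_map (word_inverse u)"
    by (auto simp: H_subgroup_def word_map_inverse)
  then show "inv\<^bsub>\<F> P\<^esub> x \<in> H_subgroup P a0"
    unfolding H_subgroup_def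
    by (intro CollectI exI[of _ "word_inverse u"]) (auto simp: inv_word_class)
qed (auto simp: H_subgroup_def)

text \<open>Elements of \<open>P\<close> and the identity can be treated alike: the identity is the
  empty word, whose \<open>word_map\<close> is \<open>Id\<close>.\<close>

lemma letters_to_word:
  assumes "x \<in> letters_to P a0 a"
  obtains w where "w \<in> lists P" "x = word_class P w" "(a0, a) \<in> word_map w"
proof (cases "\<exists>p\<in>P. x = word_class P [p] \<and> (a0, a) \<in> p")
  case True
  then obtain p where "p \<in> P" "x = word_class P [p]" "(a0, a) \<in> p" by blast
  then show ?thesis by (intro that[of "[p]"]) auto
next
  case False
  with assms show ?thesis
    by (intro that[of "[]"]) (auto simp: letters_to_def one_free_group split: if_splits)
qed

lemma letters_to_carrier: "x \<in> letters_to P a0 a \<Longrightarrow> x \<in> carrier (\<F> P)"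
  by (erule letters_to_word) simp

end

section \<open>Extending a map on letters to a homomorphism\<close>

locale converse_hom = converse_closed P + K: group K
  for P :: "'a pmap set" and K :: "('g, 'm) monoid_scheme" (structure) and \<phi> :: "'a pmap \<Rightarrow> 'g" +
  assumes gen_closed: "\<phi> \<in> P \<rightarrow> carrier K"
    and gen_converse: "\<And>p. p \<in> P \<Longrightarrow> \<phi> (converse p) = inv\<^bsub>K\<^esub> (\<phi> p)"
begin

text \<open>The fold inside \<open>hom_extension\<close>, isolated so that its constancy on classes
  can be proved before the definite description is resolved.\<close>

definition eval_word :: "'a pmap list \<Rightarrow> 'g" where
  "eval_word w = foldr (\<lambda>p x. \<phi> p \<otimes>\<^bsub>K\<^esub> x) w \<one>\<^bsub>K\<^esub>"

lemma gen_carrier [simp]: "p \<in> P \<Longrightarrow> \<phi> p \<in> carrier K"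
  using gen_closed by blast

lemma eval_word_Nil [simp]: "eval_word [] = \<one>\<^bsub>K\<^esub>"
  and eval_word_Cons [simp]: "eval_word (p # w) = \<phi> p \<otimes>\<^bsub>K\<^esub> eval_word w"
  by (simp_all add: eval_word_def)

lemma eval_word_carrier [simp]: "w \<in> lists P \<Longrightarrow> eval_word w \<in> carrier K"
  by (induction w) auto

lemma eval_word_append [simp]:
  "\<lbrakk>u \<in> lists P; v \<in> lists P\<rbrakk> \<Longrightarrow> eval_word (u @ v) = eval_word u \<otimes>\<^bsub>K\<^esub> eval_word v"
  by (induction u) (auto simp: K.m_assoc)

text \<open>A deleted pair contributes \<open>\<phi> p\<close> times its inverse, by
  \<open>gen_converse\<close>.\<close>

lemma eval_word_equiv:
  assumes "(u, v) \<in> word_equiv P"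
  shows "eval_word u = eval_word v"
proof (rule word_equiv_invariant[OF _ assms])
  fix u v p assume *: "u \<in> lists P" "v \<in> lists P" "p \<in> P"
  then have "eval_word ([p, converse p] @ v) = eval_word v"
    by (simp add: gen_converse flip: K.m_assoc)
  moreover have "[p, converse p] @ v \<in> lists P" using * by auto
  ultimately show "eval_word (u @ p # converse p # v) = eval_word (u @ v)"
    using * eval_word_append[of u "[p, converse p] @ v"] by simp
qed

lemma hom_extension_word_class [simp]: "hom_extension K \<phi> (word_class P w) = eval_word w"
  unfolding hom_extension_def eval_word_def[symmetric]
  by (rule the_equality) (auto simp: word_class_def dest: eval_word_equiv)

lemma hom_extension_hom: "hom_extension K \<phi> \<in> hom (\<F> P) K"
  by (rule homI) (auto simp: carrier_free_group)

sublocale ext: group_hom "\<F> P" K "hom_extension K \<phi>"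
  by unfold_locales (rule hom_extension_hom)

end

section \<open>The isometry group\<close>

lemma carrier_iso_group:
  "carrier (iso_group Y e) = {f \<in> Bij Y. \<forall>x\<in>Y. \<forall>y\<in>Y. e (f x) (f y) = e x y}"
  by (simp add: iso_group_def)

lemma iso_group_bij: "f \<in> carrier (iso_group Y e) \<Longrightarrow> bij_betw f Y Y"
  by (simp add: carrier_iso_group Bij_def)

lemma iso_group_closed: "\<lbrakk>f \<in> carrier (iso_group Y e); x \<in> Y\<rbrakk> \<Longrightarrow> f x \<in> Y"
  by (metis iso_group_bij bij_betwE)

lemma iso_group_dist:
  "\<lbrakk>f \<in> carrier (iso_group Y e); x \<in> Y; y \<in> Y\<rbrakk> \<Longrightarrow> e (f x) (f y) = e x y"
  by (simp add: carrier_iso_group)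

lemma iso_group_mult:
  "\<lbrakk>f \<in> carrier (iso_group Y e); g \<in> carrier (iso_group Y e); x \<in> Y\<rbrakk>
    \<Longrightarrow> (f \<otimes>\<^bsub>iso_group Y e\<^esub> g) x = f (g x)"
  by (simp add: carrier_iso_group) (simp add: iso_group_def BijGroup_def compose_def)

lemma iso_group_one: "x \<in> Y \<Longrightarrow> \<one>\<^bsub>iso_group Y e\<^esub> x = x"
  by (simp add: iso_group_def BijGroup_def)

lemma group_iso_group: "group (iso_group Y e)"
proof -
  let ?S = "{f \<in> Bij Y. \<forall>x\<in>Y. \<forall>y\<in>Y. e (f x) (f y) = e x y}"
  have "subgroup ?S (BijGroup Y)"
  proof (rule group.subgroupI[OF group_BijGroup])
    show "?S \<subseteq> carrier (BijGroup Y)" by (auto simp: BijGroup_def)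
    show "?S \<noteq> {}"
      using id_Bij[of Y] by (auto intro!: exI[of _ "\<lambda>x\<in>Y. x"])
  next
    fix f assume f: "f \<in> ?S"
    \<comment> \<open>The inverse in \<open>BijGroup Y\<close> is the restriction of
      \<open>inv_into Y f\<close> to \<open>Y\<close>; its isometry property is that of
      \<open>f\<close> at the preimages.\<close>
    then have inj: "f (inv_into Y f y) = y" "inv_into Y f y \<in> Y" if "y \<in> Y" for y
      using that Bij_inv_into_mem[of f Y y] bij_betw_inv_into_right[of f Y Y y]
      by (auto simp: Bij_def)
    have "e (inv_into Y f x) (inv_into Y f y) = e x y" if "x \<in> Y" "y \<in> Y" for x y
      using f inj[OF that(1)] inj[OF that(2)] by fastforce
    with f show "inv\<^bsub>BijGroup Y\<^esub> f \<in> ?S"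
      by (simp add: inv_BijGroup restrict_inv_into_Bij)
  next
    fix f g assume "f \<in> ?S" "g \<in> ?S"
    then show "f \<otimes>\<^bsub>BijGroup Y\<^esub> g \<in> ?S"
      using Bij_imp_funcset[of g Y] compose_Bij[of f Y g]
      by (auto simp: BijGroup_def compose_def Pi_iff)
  qed
  then show ?thesis
    unfolding iso_group_def by (rule group.subgroup_imp_group[OF group_BijGroup])
qed

text \<open>Elements of \<open>Bij Y\<close> are extensional, with a fixed value outside
  \<open>Y\<close>, so they lie in the finite set \<open>Y \<rightarrow>\<^sub>E Y\<close>.\<close>

lemma finite_iso_group: "finite Y \<Longrightarrow> finite (carrier (iso_group Y e))"
  by (rule finite_subset[of _ "Y \<rightarrow>\<^sub>E Y"])
    (auto simp: carrier_iso_group Bij_def bij_betw_def PiE_iff extensional_def intro!: finite_PiE)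

section \<open>Metric identification\<close>

locale pseudometric_on =
  fixes V :: "'v set" and \<rho> :: "'v \<Rightarrow> 'v \<Rightarrow> real"
  assumes pseudometric: "pseudometric V \<rho>"
begin

lemma self_dist [simp]: "x \<in> V \<Longrightarrow> \<rho> x x = 0"
  and dist_sym: "\<lbrakk>x \<in> V; y \<in> V\<rbrakk> \<Longrightarrow> \<rho> x y = \<rho> y x"
  and dist_triangle: "\<lbrakk>x \<in> V; y \<in> V; z \<in> V\<rbrakk> \<Longrightarrow> \<rho> x z \<le> \<rho> x y + \<rho> y z"
  using pseudometric by (auto simp: pseudometric_def)

definition point_class :: "'v \<Rightarrow> 'v set" where
  "point_class x = zero_dist V \<rho> `` {x}"

lemma mem_point_class: "y \<in> point_class x \<longleftrightarrow> x \<in> V \<and> y \<in> V \<and> \<rho> x y = 0"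
  by (simp add: point_class_def zero_dist_def)

lemma point_class_self [simp]: "x \<in> V \<Longrightarrow> x \<in> point_class x"
  by (simp add: mem_point_class)

lemma metric_ident_image: "metric_ident V \<rho> = point_class ` V"
  by (auto simp: metric_ident_def quotient_def point_class_def)

text \<open>Moving either point by distance zero costs nothing in the triangle inequality, so each
  side bounds the other.\<close>

lemma dist_cong_zero:
  assumes "x \<in> V" "x' \<in> V" "y \<in> V" "y' \<in> V" "\<rho> x x' = 0" "\<rho> y y' = 0"
  shows "\<rho> x' y' = \<rho> x y"
  using dist_triangle[of x' x y'] dist_triangle[of x y y'] dist_triangle[of x x' y]
    dist_triangle[of x' y' y] dist_sym[of x' x] dist_sym[of y' y] assms
  by linarith

lemma point_class_eq:
  assumes "x \<in> V" "y \<in> V" "\<rho> x y = 0"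
  shows "point_class x = point_class y"
proof (rule Set.set_eqI)
  fix z
  show "z \<in> point_class x \<longleftrightarrow> z \<in> point_class y"
    using assms dist_cong_zero[of x y z z] by (auto simp: mem_point_class)
qed

text \<open>By \<open>dist_cong_zero\<close> the distance is constant on a product of two classes,
  and nonemptiness of the classes makes the described value unique.\<close>

lemma ident_dist_point_class [simp]:
  assumes "x \<in> V" "y \<in> V"
  shows "ident_dist \<rho> (point_class x) (point_class y) = \<rho> x y"
  unfolding ident_dist_def
proof (rule the_equality)
  show "\<forall>x'\<in>point_class x. \<forall>y'\<in>point_class y. \<rho> x' y' = \<rho> x y"
    using assms by (intro ballI dist_cong_zero) (auto simp: mem_point_class)
  show "t = \<rho> x y" if "\<forall>x'\<in>point_class x. \<forall>y'\<in>point_class y. \<rho> x' y' = t" for t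
    using that assms by (metis point_class_self)
qed

text \<open>A distance-preserving map sends a class into a single class; closing the image under
  \<open>zero_dist\<close> yields all of that class.\<close>

lemma ident_map_point_class:
  assumes "f \<in> V \<rightarrow> V" "\<And>x y. \<lbrakk>x \<in> V; y \<in> V\<rbrakk> \<Longrightarrow> \<rho> (f x) (f y) = \<rho> x y" "x \<in> V"
  shows "ident_map V \<rho> f (point_class x) = point_class (f x)"
proof -
  have "point_class (f y) = point_class (f x)" if "y \<in> point_class x" for y
    using that assms by (intro point_class_eq[symmetric]) (auto simp: mem_point_class Pi_iff)
  then have "zero_dist V \<rho> `` (f ` point_class x) = point_class (f x)"
    using assms(3) point_class_self unfolding point_class_def by blast
  with assms(3) show ?thesis by (simp add: ident_map_def metric_ident_image)
qed

end

section \<open>Cosets\<close>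

lemma set_multI: "\<lbrakk>x \<in> A; y \<in> B\<rbrakk> \<Longrightarrow> x \<otimes>\<^bsub>G\<^esub> y \<in> A <#>\<^bsub>G\<^esub> B"
  by (auto simp: set_mult_def)

lemma (in group) inv_mult_cancel:
  assumes "x \<in> carrier G" "y \<in> carrier G"
  shows "inv x \<otimes> (x \<otimes> y) = y" "x \<otimes> (inv x \<otimes> y) = y"
  using assms by (simp_all flip: m_assoc)

lemma (in group) l_coset_eq_iff:
  assumes "subgroup S G" "x \<in> carrier G" "y \<in> carrier G"
  shows "x <# S = y <# S \<longleftrightarrow> inv x \<otimes> y \<in> S"
proof
  assume "x <# S = y <# S"
  then have "y \<in> x <# S" using assms lcos_self by blast
  with assms show "inv x \<otimes> y \<in> S"
    by (intro subgroup.lcos_module_imp is_group)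
next
  assume "inv x \<otimes> y \<in> S"
  with assms have "y \<in> x <# S"
    by (intro subgroup.lcos_module_rev is_group)
  with assms show "x <# S = y <# S" by (intro l_repr_independence)
qed

lemma (in normal) lcosets_eq_rcosets: "lcosets H = rcosets H"
  using coset_eq by (auto simp: LCOSETS_def RCOSETS_def)

text \<open>Every coset of \<open>S\<close> contains a coset of \<open>N\<close>, and any element of
  the latter recovers the former, so \<open>S\<close> has no more cosets than
  \<open>N\<close>.\<close>

lemma (in group) finite_lcosets_mono:
  assumes "subgroup N G" "subgroup S G" "N \<subseteq> S" "finite (lcosets N)"
  shows "finite (lcosets S)"
proof (rule finite_surj[OF assms(4)])
  show "lcosets S \<subseteq> (\<lambda>C. (SOME g. g \<in> C) <# S) ` (lcosets N)"
  proof
    fix C assume "C \<in> lcosets S"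
    then obtain g where g: "g \<in> carrier G" "C = g <# S" by (auto simp: LCOSETS_def)
    \<comment> \<open>The same choice that the map in the goal makes at
      \<open>g <# N\<close>.\<close>
    define h where "h = (SOME h. h \<in> g <# N)"
    have h: "h \<in> g <# N"
      unfolding h_def using lcos_self[OF g(1) assms(1)] by (rule someI)
    then have "h \<in> g <# S" using assms(3) by (auto simp: l_coset_def)
    then have "C = h <# S"
      using g assms(2) l_repr_independence by blast
    then show "C \<in> (\<lambda>C. (SOME g. g \<in> C) <# S) ` (lcosets N)"
      using g by (auto simp: h_def LCOSETS_def)
  qed
qed

text \<open>The quotient by the kernel embeds in \<open>H\<close>: a coset is sent to the single
  value that \<open>h\<close> takes on it.\<close>

lemma (in group_hom) finite_rcosets_kernel:
  assumes "finite (carrier H)"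
  shows "finite (rcosets (kernel G H h))"
proof (rule finite_imageD)
  have "(\<lambda>X. the_elem (h ` X)) ` carrier (G Mod kernel G H h) \<subseteq> carrier H"
    using FactGroup_hom by (auto simp: hom_def)
  then show "finite ((\<lambda>X. the_elem (h ` X)) ` (rcosets (kernel G H h)))"
    using assms finite_subset by (auto simp: FactGroup_def)
  show "inj_on (\<lambda>X. the_elem (h ` X)) (rcosets (kernel G H h))"
    using FactGroup_inj_on by (simp add: FactGroup_def)
qed

section \<open>The graph \<open>\<Gamma>\<^sub>N\<close>\<close>

locale pointed_partial_isometries = converse_closed P + X: Metric_space X d
  for P :: "'a pmap set" and X :: "'a set" and d :: "'a \<Rightarrow> 'a \<Rightarrow> real" +
  fixes a0 :: 'a
  assumes base_point: "a0 \<in> X"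
    and partial_isometries: "P \<subseteq> nontrivial_partial_isometries X d"
    and letters_cover: "X - {a0} \<subseteq> values_at P a0"
begin

lemma letter_subset: "p \<in> P \<Longrightarrow> p \<subseteq> X \<times> X"
  using partial_isometries by (auto simp: nontrivial_partial_isometries_def partial_isometry_def)

lemma letters_to_mem: "x \<in> letters_to P a0 a \<Longrightarrow> a \<in> X"
  using letter_subset base_point by (auto simp: letters_to_def split: if_splits)

lemma letters_to_nonempty: "a \<in> X \<Longrightarrow> \<exists>x. x \<in> letters_to P a0 a"
  using letters_cover by (cases "a = a0") (auto simp: letters_to_def values_at_def)

end

locale normal_word_subgroup = pointed_partial_isometries P X d a0 + N: normal N "\<F> P"
  for P :: "'a pmap set" and X :: "'a set" and d :: "'a \<Rightarrow> 'a \<Rightarrow> real" and a0 :: 'a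
    and N :: "'a pmap list set set"
begin

abbreviation H :: "'a pmap list set set" where
  "H \<equiv> H_subgroup P a0"

abbreviation vertex :: "'a pmap list set \<Rightarrow> 'a pmap list set set" where
  "vertex g \<equiv> g <#\<^bsub>\<F> P\<^esub> NH a0 P N"

lemma subgroup_NH: "subgroup (NH a0 P N) (\<F> P)"
  unfolding NH_def by (rule F.mult_norm_subgroup[OF N.normal_axioms subgroup_H_subgroup])

lemma H_carrier: "h \<in> H \<Longrightarrow> h \<in> carrier (\<F> P)"
  using subgroup.mem_carrier[OF subgroup_H_subgroup] .

lemma NH_E:
  assumes "x \<in> NH a0 P N"
  obtains n h where "n \<in> N" "h \<in> H" "x = n \<otimes>\<^bsub>\<F> P\<^esub> h"
  using assms by (auto simp: NH_def set_mult_def)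

lemma N_subset_NH: "N \<subseteq> NH a0 P N"
proof
  fix n assume "n \<in> N"
  then have "n = n \<otimes>\<^bsub>\<F> P\<^esub> \<one>\<^bsub>\<F> P\<^esub>" "\<one>\<^bsub>\<F> P\<^esub> \<in> H"
    using subgroup.one_closed[OF subgroup_H_subgroup] N.mem_carrier by auto
  with \<open>n \<in> N\<close> show "n \<in> NH a0 P N" unfolding NH_def set_mult_def by blast
qed

lemma H_subset_NH: "H \<subseteq> NH a0 P N"
proof
  fix h assume "h \<in> H"
  then have "h = \<one>\<^bsub>\<F> P\<^esub> \<otimes>\<^bsub>\<F> P\<^esub> h" using H_carrier by simp
  with \<open>h \<in> H\<close> show "h \<in> NH a0 P N" unfolding NH_def set_mult_def using N.one_closed by blast
qed

lemma Gam_image: "Gam a0 P N = vertex ` carrier (\<F> P)"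
  by (auto simp: Gam_def LCOSETS_def)

lemma vertex_Gam [simp]: "g \<in> carrier (\<F> P) \<Longrightarrow> vertex g \<in> Gam a0 P N"
  by (simp add: Gam_image)

lemma vertex_eq_iff:
  "\<lbrakk>x \<in> carrier (\<F> P); y \<in> carrier (\<F> P)\<rbrakk>
    \<Longrightarrow> vertex x = vertex y \<longleftrightarrow> inv\<^bsub>\<F> P\<^esub> x \<otimes>\<^bsub>\<F> P\<^esub> y \<in> NH a0 P N"
  by (rule F.l_coset_eq_iff[OF subgroup_NH])

lemma Phi_vertex:
  assumes "g \<in> carrier (\<F> P)" "h \<in> carrier (\<F> P)"
  shows "Phi a0 P N g (vertex h) = vertex (g \<otimes>\<^bsub>\<F> P\<^esub> h)"
  using assms subgroup.subset[OF subgroup_NH] by (simp add: Phi_def F.lcos_m_assoc)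

text \<open>The two words differ by an element of \<open>H\<close>, which \<open>NH\<close> absorbs.
  Hence the vertex \<open>pNH\<close> depends only on \<open>p(a0)\<close>.\<close>

lemma vertex_word_eq:
  assumes "u \<in> lists P" "v \<in> lists P" "(a0, a) \<in> word_map u" "(a0, a) \<in> word_map v"
  shows "vertex (word_class P u) = vertex (word_class P v)"
  using inv_mult_mem_H_subgroup[OF assms] assms H_subset_NH by (subst vertex_eq_iff) auto

text \<open>Cosets of \<open>NH\<close> are unions of cosets of \<open>N\<close>. For normal
  \<open>N\<close> left and right cosets coincide, which links \<open>Gam\<close> to an index stated
  with \<open>rcosets\<close>.\<close>

lemma finite_Gam:
  assumes "finite (rcosets\<^bsub>\<F> P\<^esub> N)"
  shows "finite (Gam a0 P N)"
  unfolding Gam_def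
  by (rule F.finite_lcosets_mono[OF N.subgroup_axioms subgroup_NH N_subset_NH])
    (use assms N.lcosets_eq_rcosets in simp)

end

section \<open>From extensions to pseudometrics\<close>

lemma isometry_pair_converse_hom:
  assumes "converse ` P = P" "isometry_pair P Y e \<phi>"
  shows "converse_hom P (iso_group Y e) \<phi>"
  using assms group_iso_group[of Y e]
  by (simp add: converse_hom_def converse_closed_def converse_hom_axioms_def isometry_pair_def)

locale pointed_extension = pointed_partial_isometries P X d a0
  for P :: "'a pmap set" and X :: "'a set" and d :: "'a \<Rightarrow> 'a \<Rightarrow> real" and a0 :: 'a +
  fixes Y :: "'b set" and e :: "'b \<Rightarrow> 'b \<Rightarrow> real" and \<phi> :: "'a pmap \<Rightarrow> 'b \<Rightarrow> 'b" and \<iota> :: "'a \<Rightarrow> 'b"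
  assumes extension: "S_extension X d P Y e \<phi> \<iota>"
begin

sublocale converse_hom P "iso_group Y e" \<phi>
  by (rule isometry_pair_converse_hom)
    (use extension converse_image in \<open>auto simp: S_extension_def\<close>)

sublocale Y: Metric_space Y e
  using extension by (simp add: S_extension_def isometry_pair_def)

lemma embed_closed [simp]: "x \<in> X \<Longrightarrow> \<iota> x \<in> Y"
  and embed_dist [simp]: "\<lbrakk>x \<in> X; y \<in> X\<rbrakk> \<Longrightarrow> e (\<iota> x) (\<iota> y) = d x y"
  and embed_letter: "\<lbrakk>p \<in> P; (x, y) \<in> p\<rbrakk> \<Longrightarrow> \<phi> p (\<iota> x) = \<iota> y"
  using extension by (auto simp: S_extension_def)

declare ext.hom_mult [simp del] ext.hom_one [simp del] ext.hom_inv [simp del]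

abbreviation act :: "'a pmap list set \<Rightarrow> 'b \<Rightarrow> 'b" where
  "act \<equiv> hom_extension (iso_group Y e) \<phi>"

abbreviation orbit_pt :: "'a pmap list set \<Rightarrow> 'b" where
  "orbit_pt g \<equiv> act g (\<iota> a0)"

lemma act_closed [simp]: "\<lbrakk>g \<in> carrier (\<F> P); y \<in> Y\<rbrakk> \<Longrightarrow> act g y \<in> Y"
  by (rule iso_group_closed[OF ext.hom_closed])

lemma orbit_pt_closed [simp]: "g \<in> carrier (\<F> P) \<Longrightarrow> orbit_pt g \<in> Y"
  by (simp add: base_point)

lemma act_mult:
  "\<lbrakk>g \<in> carrier (\<F> P); h \<in> carrier (\<F> P); y \<in> Y\<rbrakk> \<Longrightarrow> act (g \<otimes>\<^bsub>\<F> P\<^esub> h) y = act g (act h y)"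
  by (simp add: ext.hom_mult iso_group_mult)

lemma orbit_pt_mult:
  "\<lbrakk>g \<in> carrier (\<F> P); h \<in> carrier (\<F> P)\<rbrakk> \<Longrightarrow> orbit_pt (g \<otimes>\<^bsub>\<F> P\<^esub> h) = act g (orbit_pt h)"
  by (simp add: act_mult base_point)

lemma act_dist:
  "\<lbrakk>g \<in> carrier (\<F> P); x \<in> Y; y \<in> Y\<rbrakk> \<Longrightarrow> e (act g x) (act g y) = e x y"
  by (rule iso_group_dist[OF ext.hom_closed])

lemma orbit_pt_dist:
  "\<lbrakk>g \<in> carrier (\<F> P); h \<in> carrier (\<F> P); k \<in> carrier (\<F> P)\<rbrakk>
    \<Longrightarrow> e (orbit_pt (g \<otimes>\<^bsub>\<F> P\<^esub> h)) (orbit_pt (g \<otimes>\<^bsub>\<F> P\<^esub> k)) = e (orbit_pt h) (orbit_pt k)"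
  by (simp add: orbit_pt_mult act_dist)

lemma orbit_pt_one [simp]: "orbit_pt \<one>\<^bsub>\<F> P\<^esub> = \<iota> a0"
  by (simp add: ext.hom_one iso_group_one base_point)

text \<open>Apply the isometry \<open>act r\<close> to both points.\<close>

lemma orbit_pt_dist_inv:
  assumes "r \<in> carrier (\<F> P)" "s \<in> carrier (\<F> P)"
  shows "e (\<iota> a0) (orbit_pt (inv\<^bsub>\<F> P\<^esub> r \<otimes>\<^bsub>\<F> P\<^esub> s)) = e (orbit_pt r) (orbit_pt s)"
  using orbit_pt_dist[of r "\<one>\<^bsub>\<F> P\<^esub>" "inv\<^bsub>\<F> P\<^esub> r \<otimes>\<^bsub>\<F> P\<^esub> s"] assms
  by (simp flip: F.m_assoc)

text \<open>The extension property passes from letters to words: each intermediate point of the path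
  of \<open>x\<close> stays in \<open>X\<close>, where the next letter acts as the partial isometry
  that it is. For words fixing \<open>a0\<close> it shows that \<open>H\<close> fixes
  \<open>\<iota> a0\<close>.\<close>

lemma eval_word_embed:
  "\<lbrakk>w \<in> lists P; (x, y) \<in> word_map w; x \<in> X\<rbrakk> \<Longrightarrow> y \<in> X \<and> eval_word w (\<iota> x) = \<iota> y"
proof (induction w arbitrary: y)
  case Nil
  then show ?case by (simp add: iso_group_one)
next
  case (Cons p w)
  then obtain z where z: "(x, z) \<in> word_map w" "(z, y) \<in> p" by auto
  with Cons have "z \<in> X" "eval_word w (\<iota> x) = \<iota> z" "p \<in> P" by auto
  with z Cons.prems letter_subset[of p] show ?case
    by (auto simp: iso_group_mult embed_letter)
qed

lemma orbit_pt_letter: "x \<in> letters_to P a0 a \<Longrightarrow> orbit_pt x = \<iota> a"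
  by (erule letters_to_word) (use eval_word_embed base_point in auto)

lemma orbit_pt_H: "h \<in> H_subgroup P a0 \<Longrightarrow> orbit_pt h = \<iota> a0"
  using eval_word_embed base_point by (auto simp: H_subgroup_def)

abbreviation "K \<equiv> kernel (\<F> P) (iso_group Y e) act"

sublocale normal_word_subgroup P X d a0 K
  by (intro normal_word_subgroup.intro pointed_partial_isometries_axioms ext.normal_kernel)

lemma act_kernel: "\<lbrakk>n \<in> K; y \<in> Y\<rbrakk> \<Longrightarrow> act n y = y"
  unfolding kernel_def by (simp add: iso_group_one)

lemma orbit_pt_mult_H:
  "\<lbrakk>g \<in> carrier (\<F> P); h \<in> H\<rbrakk> \<Longrightarrow> orbit_pt (g \<otimes>\<^bsub>\<F> P\<^esub> h) = orbit_pt g"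
  by (simp add: orbit_pt_mult orbit_pt_H H_carrier)

lemma orbit_pt_NH: "s \<in> NH a0 P K \<Longrightarrow> orbit_pt s = \<iota> a0"
  by (erule NH_E)
    (simp add: orbit_pt_mult H_carrier orbit_pt_H act_kernel base_point)

text \<open>The conditions (C1)--(C3) all reduce to this: if \<open>p m q\<^sup>-\<^sup>1\<close> acts trivially, then \<open>q\<close> and \<open>p m\<close>
  move the base point to the same place.\<close>

lemma kernel_dist:
  assumes "p \<otimes>\<^bsub>\<F> P\<^esub> m \<otimes>\<^bsub>\<F> P\<^esub> inv\<^bsub>\<F> P\<^esub> q \<in> K"
    and [simp]: "p \<in> carrier (\<F> P)" "m \<in> carrier (\<F> P)" "q \<in> carrier (\<F> P)"
  shows "e (orbit_pt p) (orbit_pt q) = e (\<iota> a0) (orbit_pt m)"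
proof -
  have "orbit_pt q = act (p \<otimes>\<^bsub>\<F> P\<^esub> m \<otimes>\<^bsub>\<F> P\<^esub> inv\<^bsub>\<F> P\<^esub> q) (orbit_pt q)"
    by (rule act_kernel[symmetric, OF assms(1)]) simp
  also have "\<dots> = orbit_pt (p \<otimes>\<^bsub>\<F> P\<^esub> m \<otimes>\<^bsub>\<F> P\<^esub> inv\<^bsub>\<F> P\<^esub> q \<otimes>\<^bsub>\<F> P\<^esub> q)"
    by (rule orbit_pt_mult[symmetric]) simp_all
  also have "\<dots> = orbit_pt (p \<otimes>\<^bsub>\<F> P\<^esub> m)"
    by (simp add: F.m_assoc)
  finally show ?thesis
    using orbit_pt_dist[of p "\<one>\<^bsub>\<F> P\<^esub>" m] by simp
qed

lemma letters_dist:
  assumes "p \<in> letters_to P a0 a" "q \<in> letters_to P a0 b"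
  shows "e (orbit_pt p) (orbit_pt q) = d a b"
  using assms letters_to_mem by (simp add: orbit_pt_letter)

section \<open>The conditions (C1)-(C3) for the kernel\<close>

lemma cond_C1_kernel: "cond_C1 d a0 P K"
proof -
  \<comment> \<open>Of the factors from \<open>H\<close>, \<open>h'\<close> drops out because it
    fixes the base point, and \<open>h\<close> because it is moreover an isometry.\<close>
  have "d a b = d c f"
    if l: "p \<in> letters_to P a0 a" "q \<in> letters_to P a0 b" "r \<in> letters_to P a0 c" "s \<in> letters_to P a0 f"
      and h: "h \<in> H" "h' \<in> H"
      and K: "p \<otimes>\<^bsub>\<F> P\<^esub> h \<otimes>\<^bsub>\<F> P\<^esub> (inv\<^bsub>\<F> P\<^esub> r \<otimes>\<^bsub>\<F> P\<^esub> s) \<otimes>\<^bsub>\<F> P\<^esub> h' \<otimes>\<^bsub>\<F> P\<^esub> inv\<^bsub>\<F> P\<^esub> q \<in> K"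
    for a b c f p q r s h h'
  proof -
    note [simp] = letters_to_carrier[OF l(1)] letters_to_carrier[OF l(2)] letters_to_carrier[OF l(3)]
      letters_to_carrier[OF l(4)] H_carrier[OF h(1)] H_carrier[OF h(2)]
    have "d a b = e (\<iota> a0) (orbit_pt (h \<otimes>\<^bsub>\<F> P\<^esub> (inv\<^bsub>\<F> P\<^esub> r \<otimes>\<^bsub>\<F> P\<^esub> s) \<otimes>\<^bsub>\<F> P\<^esub> h'))"
      using kernel_dist[of p "h \<otimes>\<^bsub>\<F> P\<^esub> (inv\<^bsub>\<F> P\<^esub> r \<otimes>\<^bsub>\<F> P\<^esub> s) \<otimes>\<^bsub>\<F> P\<^esub> h'" q] K
      by (simp add: F.m_assoc letters_dist[OF l(1,2)])
    also have "\<dots> = e (orbit_pt h) (orbit_pt (h \<otimes>\<^bsub>\<F> P\<^esub> (inv\<^bsub>\<F> P\<^esub> r \<otimes>\<^bsub>\<F> P\<^esub> s)))"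
      by (subst orbit_pt_mult_H) (simp_all add: h orbit_pt_H)
    also have "\<dots> = e (\<iota> a0) (orbit_pt (inv\<^bsub>\<F> P\<^esub> r \<otimes>\<^bsub>\<F> P\<^esub> s))"
      using orbit_pt_dist[of h "\<one>\<^bsub>\<F> P\<^esub>" "inv\<^bsub>\<F> P\<^esub> r \<otimes>\<^bsub>\<F> P\<^esub> s"]
      by simp
    also have "\<dots> = d c f"
      by (simp add: orbit_pt_dist_inv letters_dist[OF l(3,4)])
    finally show ?thesis .
  qed
  then show ?thesis
    unfolding cond_C1_def set_mult_def by blast
qed

text \<open>The middle factor \<open>h\<close> fixes the base point, so \<open>kernel_dist\<close>
  gives distance zero.\<close>

lemma cond_C2_kernel: "cond_C2 a0 P K"
proof -
  have "a = b"
    if l: "p \<in> letters_to P a0 a" "q \<in> letters_to P a0 b" and "h \<in> H"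
      and "p \<otimes>\<^bsub>\<F> P\<^esub> h \<otimes>\<^bsub>\<F> P\<^esub> inv\<^bsub>\<F> P\<^esub> q \<in> K"
    for a b p q h
  proof -
    have "d a b = 0"
      using kernel_dist[of p h q] that letters_to_carrier H_carrier base_point
      by (auto simp: letters_dist orbit_pt_H)
    then show ?thesis
      using l letters_to_mem by simp
  qed
  then show ?thesis
    unfolding cond_C2_def set_mult_def by blast
qed

text \<open>Induction along the chain: the leading \<open>h\<close> is an isometry fixing the base
  point, and a detour through the image of the base point under \<open>r^-1 s\<close> splits off one
  summand. Translating back by \<open>r^-1 s\<close> leaves the shorter chain.\<close>

lemma chain_dist:
  assumes "m \<in> chain P H rss" "\<And>r s. (r, s) \<in> set rss \<Longrightarrow> r \<in> carrier (\<F> P) \<and> s \<in> carrier (\<F> P)"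
  shows "m \<in> carrier (\<F> P) \<and> e (\<iota> a0) (orbit_pt m) \<le> (\<Sum>(r, s)\<leftarrow>rss. e (orbit_pt r) (orbit_pt s))"
  using assms
proof (induction rss arbitrary: m)
  case Nil
  then show ?case by (simp add: H_carrier orbit_pt_H base_point)
next
  case (Cons rs rss)
  obtain r s where rs: "rs = (r, s)" by fastforce
  with Cons.prems obtain h m' where h: "h \<in> H" and m': "m' \<in> chain P H rss"
    and m: "m = h \<otimes>\<^bsub>\<F> P\<^esub> (inv\<^bsub>\<F> P\<^esub> r \<otimes>\<^bsub>\<F> P\<^esub> s) \<otimes>\<^bsub>\<F> P\<^esub> m'"
    by (auto simp: set_mult_def)
  have [simp]: "r \<in> carrier (\<F> P)" "s \<in> carrier (\<F> P)" "h \<in> carrier (\<F> P)"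
    using Cons.prems rs h H_carrier by auto
  have IH: "m' \<in> carrier (\<F> P)"
    "e (\<iota> a0) (orbit_pt m') \<le> (\<Sum>(r, s)\<leftarrow>rss. e (orbit_pt r) (orbit_pt s))"
    using Cons.IH[OF m'] Cons.prems(2) by auto
  let ?k = "inv\<^bsub>\<F> P\<^esub> r \<otimes>\<^bsub>\<F> P\<^esub> s"
  have "e (\<iota> a0) (orbit_pt m) = e (orbit_pt (h \<otimes>\<^bsub>\<F> P\<^esub> \<one>\<^bsub>\<F> P\<^esub>)) (orbit_pt (h \<otimes>\<^bsub>\<F> P\<^esub> (?k \<otimes>\<^bsub>\<F> P\<^esub> m')))"
    using h IH(1) by (simp add: m orbit_pt_H F.m_assoc)
  also have "\<dots> = e (\<iota> a0) (orbit_pt (?k \<otimes>\<^bsub>\<F> P\<^esub> m'))"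
    using IH(1) by (subst orbit_pt_dist) simp_all
  also have "\<dots> \<le> e (\<iota> a0) (orbit_pt ?k) + e (orbit_pt (?k \<otimes>\<^bsub>\<F> P\<^esub> \<one>\<^bsub>\<F> P\<^esub>)) (orbit_pt (?k \<otimes>\<^bsub>\<F> P\<^esub> m'))"
    using Y.triangle[of "\<iota> a0" "orbit_pt ?k" "orbit_pt (?k \<otimes>\<^bsub>\<F> P\<^esub> m')"] IH(1) base_point
    by simp
  also have "\<dots> = e (orbit_pt r) (orbit_pt s) + e (\<iota> a0) (orbit_pt m')"
    using IH(1) by (subst orbit_pt_dist) (simp_all add: orbit_pt_dist_inv)
  finally show ?case
    using IH by (simp add: rs m)
qed

text \<open>Membership in the kernel makes \<open>d a b\<close> equal to the distance that
  \<open>chain_dist\<close> bounds, by \<open>kernel_dist\<close>.\<close>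

lemma cond_C3_kernel: "cond_C3 d a0 P K"
proof -
  have "d a b \<le> (\<Sum>i=1..n. d (c i) (f i))"
    if l: "p \<in> letters_to P a0 a" "q \<in> letters_to P a0 b"
      and rs: "\<forall>i\<in>{1..n}. r i \<in> letters_to P a0 (c i) \<and> s i \<in> letters_to P a0 (f i)"
      and m: "m \<in> chain P H (map (\<lambda>i. (r i, s i)) [1..<Suc n])"
      and K: "p \<otimes>\<^bsub>\<F> P\<^esub> m \<otimes>\<^bsub>\<F> P\<^esub> inv\<^bsub>\<F> P\<^esub> q \<in> K"
    for a b p q and n :: nat and c f r s m
  proof -
    have rs': "(i, j) \<in> set (map (\<lambda>i. (r i, s i)) [1..<Suc n]) \<Longrightarrow> i \<in> carrier (\<F> P) \<and> j \<in> carrier (\<F> P)" for i j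
      using rs letters_to_carrier by fastforce
    from chain_dist[OF m rs'] have m': "m \<in> carrier (\<F> P)"
      "e (\<iota> a0) (orbit_pt m) \<le> (\<Sum>i\<leftarrow>[1..<Suc n]. e (orbit_pt (r i)) (orbit_pt (s i)))"
      by (auto simp: comp_def simp del: upt_Suc)
    have "(\<Sum>i\<leftarrow>[1..<Suc n]. e (orbit_pt (r i)) (orbit_pt (s i))) = (\<Sum>i=1..n. e (orbit_pt (r i)) (orbit_pt (s i)))"
      by (simp add: sum_list_distinct_conv_sum_set atLeastLessThanSuc_atLeastAtMost del: upt_Suc)
    also have "\<dots> = (\<Sum>i=1..n. d (c i) (f i))"
      using rs letters_dist by (intro sum.cong) auto
    finally show ?thesis
      using kernel_dist[OF K] l m' letters_to_carrier by (simp add: letters_dist)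
  qed
  then show ?thesis
    unfolding cond_C3_def set_mult_def by (blast dest: leD)
qed

section \<open>The pseudometric pulled back from \<open>Y\<close>\<close>

definition vertex_pt :: "'a pmap list set set \<Rightarrow> 'b" where
  "vertex_pt A = orbit_pt (SOME g. g \<in> A)"

text \<open>The chosen representative differs from \<open>g\<close> by a right factor in
  \<open>NH\<close>, and such a factor fixes the base point.\<close>

lemma vertex_pt_vertex [simp]:
  assumes "g \<in> carrier (\<F> P)"
  shows "vertex_pt (vertex g) = orbit_pt g"
proof -
  have "g \<in> vertex g" using assms by (rule F.lcos_self[OF _ subgroup_NH])
  then have "(SOME g'. g' \<in> vertex g) \<in> vertex g" by (rule someI)
  then obtain s where s: "s \<in> NH a0 P K" "(SOME g'. g' \<in> vertex g) = g \<otimes>\<^bsub>\<F> P\<^esub> s"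
    by (auto simp: l_coset_def)
  have "orbit_pt (g \<otimes>\<^bsub>\<F> P\<^esub> s) = orbit_pt g"
    using s(1) assms subgroup.mem_carrier[OF subgroup_NH]
    by (simp add: orbit_pt_mult orbit_pt_NH)
  then show ?thesis by (simp add: vertex_pt_def s(2))
qed

lemma vertex_pt_closed [simp]: "A \<in> Gam a0 P K \<Longrightarrow> vertex_pt A \<in> Y"
  by (auto simp: Gam_image)

text \<open>In general only a pseudometric: the stabilizer of \<open>\<iota> a0\<close> may be
  larger than \<open>NH\<close>, and then distinct cosets lie over the same point.\<close>

definition pulled_dist :: "'a pmap list set set \<Rightarrow> 'a pmap list set set \<Rightarrow> real" where
  "pulled_dist A B = e (vertex_pt A) (vertex_pt B)"

lemma pseudometric_pulled_dist: "pseudometric (Gam a0 P K) pulled_dist"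
  unfolding pseudometric_def pulled_dist_def
  by (auto simp: Gam_image Y.commute intro!: Y.triangle)

lemma invariant_pulled_dist:
  "invariant_under (Phi a0 P K ` carrier (\<F> P)) (Gam a0 P K) pulled_dist"
  unfolding invariant_under_def pulled_dist_def
  by (auto simp: Gam_image Phi_vertex orbit_pt_dist)

text \<open>All weights that an edge can receive equal one number fixed by its endpoints. This gives
  at once the uniqueness behind the description in \<open>weight\<close> and consistency.\<close>

lemma edge_pulled_dist: "edge_with_weight d a0 P K x y t \<Longrightarrow> pulled_dist x y = t"
  unfolding edge_with_weight_def pulled_dist_def
  by (auto simp: letters_to_carrier orbit_pt_dist letters_dist)

lemma consistent_pulled_dist: "consistent_with_weight d a0 P K pulled_dist"
  unfolding consistent_with_weight_def is_edge_def weight_def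
  by (metis (mono_tags, lifting) edge_pulled_dist theI)

lemma isomorphic_pulled_dist:
  assumes "minimal_extension a0 P Y e \<phi> \<iota>"
  shows "isomorphic_pairs P Y e \<phi> (metric_ident (Gam a0 P K) pulled_dist)
    (ident_dist pulled_dist) (Phi_bar a0 P K pulled_dist)"
proof -
  interpret Q: pseudometric_on "Gam a0 P K" pulled_dist
    by unfold_locales (rule pseudometric_pulled_dist)
  \<comment> \<open>The isomorphism sends \<open>y\<close> to the fibre of \<open>vertex_pt\<close>
    over \<open>y\<close>. Fibres of points in the orbit are classes, since
    \<open>pulled_dist\<close> vanishes exactly when two vertices lie over one point.\<close>
  define \<pi> where "\<pi> y = {A \<in> Gam a0 P K. vertex_pt A = y}" for y
  have \<pi>: "\<pi> (orbit_pt g) = Q.point_class (vertex g)" if "g \<in> carrier (\<F> P)" for g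
    using that by (auto simp: \<pi>_def Q.mem_point_class pulled_dist_def)
  \<comment> \<open>By minimality every fibre contains a vertex, so \<open>\<pi>\<close> is
    injective on \<open>Y\<close> with values in the set of classes.\<close>
  have orbit: "\<exists>g\<in>carrier (\<F> P). y = orbit_pt g" if "y \<in> Y" for y
    using assms that by (simp add: minimal_extension_def)
  have "inj_on \<pi> Y"
  proof (rule inj_onI)
    fix y z assume "y \<in> Y" "z \<in> Y" "\<pi> y = \<pi> z"
    moreover from orbit[OF \<open>y \<in> Y\<close>] obtain g where "g \<in> carrier (\<F> P)" "y = orbit_pt g" by blast
    ultimately have "vertex g \<in> \<pi> z" using \<pi>[of g] by (simp add: \<pi>_def)
    with \<open>y = orbit_pt g\<close> \<open>g \<in> carrier (\<F> P)\<close> show "y = z" by (simp add: \<pi>_def)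
  qed
  have "\<pi> ` Y = metric_ident (Gam a0 P K) pulled_dist"
  proof
    show "\<pi> ` Y \<subseteq> metric_ident (Gam a0 P K) pulled_dist"
      using orbit by (force simp: \<pi> Q.metric_ident_image)
    show "metric_ident (Gam a0 P K) pulled_dist \<subseteq> \<pi> ` Y"
    proof
      fix C assume "C \<in> metric_ident (Gam a0 P K) pulled_dist"
      then obtain A where "A \<in> Gam a0 P K" "C = Q.point_class A"
        by (auto simp: Q.metric_ident_image)
      then obtain g where "g \<in> carrier (\<F> P)" "C = Q.point_class (vertex g)"
        by (auto simp: Gam_image)
      then show "C \<in> \<pi> ` Y" by (intro image_eqI[of _ _ "orbit_pt g"]) (simp_all add: \<pi>)
    qed
  qed
  have "ident_dist pulled_dist (\<pi> x) (\<pi> y) = e x y" if "x \<in> Y" "y \<in> Y" for x y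
    using orbit[OF that(1)] orbit[OF that(2)] by (auto simp: \<pi>) (simp add: pulled_dist_def)
  \<comment> \<open>Both sides are the class of the vertex of \<open>p g\<close>, where
    \<open>g\<close> moves the base point to \<open>y\<close>.\<close>
  have "Phi_bar a0 P K pulled_dist p (\<pi> y) = \<pi> (\<phi> p y)" if "p \<in> P" "y \<in> Y" for p y
  proof -
    from orbit[OF that(2)] obtain g where g: "g \<in> carrier (\<F> P)" "y = orbit_pt g" by blast
    have p: "word_class P [p] \<in> carrier (\<F> P)" using that(1) by simp
    have "Phi_bar a0 P K pulled_dist p (\<pi> y)
        = Q.point_class (Phi a0 P K (word_class P [p]) (vertex g))"
      unfolding Phi_bar_def g(2) \<pi>[OF g(1)]
    proof (rule Q.ident_map_point_class)
      show "Phi a0 P K (word_class P [p]) \<in> Gam a0 P K \<rightarrow> Gam a0 P K"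
        using p by (auto simp: Gam_image Phi_vertex)
      show "pulled_dist (Phi a0 P K (word_class P [p]) A) (Phi a0 P K (word_class P [p]) B) = pulled_dist A B"
        if "A \<in> Gam a0 P K" "B \<in> Gam a0 P K" for A B
        using invariant_pulled_dist that p by (auto simp: invariant_under_def)
    qed (use g in simp)
    also have "\<dots> = \<pi> (orbit_pt (word_class P [p] \<otimes>\<^bsub>\<F> P\<^esub> g))"
      using p g(1) by (simp add: Phi_vertex \<pi>)
    also have "orbit_pt (word_class P [p] \<otimes>\<^bsub>\<F> P\<^esub> g) = \<phi> p y"
      using p g that by (simp add: orbit_pt_mult iso_group_mult iso_group_one)
    finally show ?thesis .
  qed
  show ?thesis
    unfolding isomorphic_pairs_def bij_betw_def
    by (intro exI[of _ \<pi>] conjI ballI; fact)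
qed

end

section \<open>From pseudometrics to extensions\<close>

context normal_word_subgroup
begin

section \<open>Consequences of (C1) and (C2) for vertices and weights\<close>

lemma vertex_eqE:
  assumes "vertex x = vertex y" "x \<in> carrier (\<F> P)" "y \<in> carrier (\<F> P)"
  obtains n h where "n \<in> N" "h \<in> H" "y = x \<otimes>\<^bsub>\<F> P\<^esub> n \<otimes>\<^bsub>\<F> P\<^esub> h"
proof -
  from assms have "inv\<^bsub>\<F> P\<^esub> x \<otimes>\<^bsub>\<F> P\<^esub> y \<in> NH a0 P N" by (simp add: vertex_eq_iff)
  then obtain n h where nh: "n \<in> N" "h \<in> H" "inv\<^bsub>\<F> P\<^esub> x \<otimes>\<^bsub>\<F> P\<^esub> y = n \<otimes>\<^bsub>\<F> P\<^esub> h" by (rule NH_E)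
  have "y = x \<otimes>\<^bsub>\<F> P\<^esub> (inv\<^bsub>\<F> P\<^esub> x \<otimes>\<^bsub>\<F> P\<^esub> y)" using assms F.inv_mult_cancel by simp
  also have "\<dots> = x \<otimes>\<^bsub>\<F> P\<^esub> n \<otimes>\<^bsub>\<F> P\<^esub> h"
    unfolding nh(3) using assms(2) nh(1,2) by (simp add: F.m_assoc H_carrier)
  finally show ?thesis by (rule that[OF nh(1,2)])
qed

text \<open>If \<open>g' r = g p n h\<close> and \<open>g' s = g q m k\<close>, then
  \<open>p h (r^-1 s) k^-1 q^-1\<close> is the product of the conjugates \<open>p n^-1 p^-1\<close>
  and \<open>q m q^-1\<close>, so it lies in \<open>N\<close>. For different weights (C1) excludes
  this.\<close>

lemma edge_weight_unique:
  assumes "cond_C1 d a0 P N"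
    and "edge_with_weight d a0 P N x y t" "edge_with_weight d a0 P N x y t'"
  shows "t = t'"
proof (rule ccontr)
  assume "t \<noteq> t'"
  from assms(2) obtain g a b p q where g: "g \<in> carrier (\<F> P)"
    and pq: "p \<in> letters_to P a0 a" "q \<in> letters_to P a0 b"
    and xy: "x = vertex (g \<otimes>\<^bsub>\<F> P\<^esub> p)" "y = vertex (g \<otimes>\<^bsub>\<F> P\<^esub> q)" and t: "t = d a b"
    unfolding edge_with_weight_def by blast
  from assms(3) obtain g' c f r s where g': "g' \<in> carrier (\<F> P)"
    and rs: "r \<in> letters_to P a0 c" "s \<in> letters_to P a0 f"
    and xy': "x = vertex (g' \<otimes>\<^bsub>\<F> P\<^esub> r)" "y = vertex (g' \<otimes>\<^bsub>\<F> P\<^esub> s)" and t': "t' = d c f"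
    unfolding edge_with_weight_def by blast
  note [simp] = g g' letters_to_carrier[OF pq(1)] letters_to_carrier[OF pq(2)]
    letters_to_carrier[OF rs(1)] letters_to_carrier[OF rs(2)]
  obtain n h where n: "n \<in> N" "h \<in> H" and r: "g' \<otimes>\<^bsub>\<F> P\<^esub> r = g \<otimes>\<^bsub>\<F> P\<^esub> p \<otimes>\<^bsub>\<F> P\<^esub> n \<otimes>\<^bsub>\<F> P\<^esub> h"
    by (rule vertex_eqE[of "g \<otimes>\<^bsub>\<F> P\<^esub> p" "g' \<otimes>\<^bsub>\<F> P\<^esub> r"]) (use xy xy' in simp_all)
  obtain m k where m: "m \<in> N" "k \<in> H" and s: "g' \<otimes>\<^bsub>\<F> P\<^esub> s = g \<otimes>\<^bsub>\<F> P\<^esub> q \<otimes>\<^bsub>\<F> P\<^esub> m \<otimes>\<^bsub>\<F> P\<^esub> k"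
    by (rule vertex_eqE[of "g \<otimes>\<^bsub>\<F> P\<^esub> q" "g' \<otimes>\<^bsub>\<F> P\<^esub> s"]) (use xy xy' in simp_all)
  note [simp] = n(1)[THEN N.mem_carrier] m(1)[THEN N.mem_carrier] n(2)[THEN H_carrier] m(2)[THEN H_carrier]
  have "inv\<^bsub>\<F> P\<^esub> r \<otimes>\<^bsub>\<F> P\<^esub> s = inv\<^bsub>\<F> P\<^esub> (g' \<otimes>\<^bsub>\<F> P\<^esub> r) \<otimes>\<^bsub>\<F> P\<^esub> (g' \<otimes>\<^bsub>\<F> P\<^esub> s)"
    by (simp add: F.m_assoc F.inv_mult_group F.inv_mult_cancel)
  also have "\<dots> = inv\<^bsub>\<F> P\<^esub> h \<otimes>\<^bsub>\<F> P\<^esub> (inv\<^bsub>\<F> P\<^esub> n \<otimes>\<^bsub>\<F> P\<^esub> (inv\<^bsub>\<F> P\<^esub> p \<otimes>\<^bsub>\<F> P\<^esub> (q \<otimes>\<^bsub>\<F> P\<^esub> (m \<otimes>\<^bsub>\<F> P\<^esub> k))))"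
    unfolding r s by (simp add: F.m_assoc F.inv_mult_group F.inv_mult_cancel)
  finally have rs_eq: "inv\<^bsub>\<F> P\<^esub> r \<otimes>\<^bsub>\<F> P\<^esub> s = inv\<^bsub>\<F> P\<^esub> h \<otimes>\<^bsub>\<F> P\<^esub> (inv\<^bsub>\<F> P\<^esub> n \<otimes>\<^bsub>\<F> P\<^esub> (inv\<^bsub>\<F> P\<^esub> p \<otimes>\<^bsub>\<F> P\<^esub> (q \<otimes>\<^bsub>\<F> P\<^esub> (m \<otimes>\<^bsub>\<F> P\<^esub> k))))" .
  have "p \<otimes>\<^bsub>\<F> P\<^esub> h \<otimes>\<^bsub>\<F> P\<^esub> (inv\<^bsub>\<F> P\<^esub> r \<otimes>\<^bsub>\<F> P\<^esub> s) \<otimes>\<^bsub>\<F> P\<^esub> inv\<^bsub>\<F> P\<^esub> k \<otimes>\<^bsub>\<F> P\<^esub> inv\<^bsub>\<F> P\<^esub> q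
      = (p \<otimes>\<^bsub>\<F> P\<^esub> inv\<^bsub>\<F> P\<^esub> n \<otimes>\<^bsub>\<F> P\<^esub> inv\<^bsub>\<F> P\<^esub> p) \<otimes>\<^bsub>\<F> P\<^esub> (q \<otimes>\<^bsub>\<F> P\<^esub> m \<otimes>\<^bsub>\<F> P\<^esub> inv\<^bsub>\<F> P\<^esub> q)"
    unfolding rs_eq by (simp add: F.m_assoc F.inv_mult_cancel)
  also have "\<dots> \<in> N"
    using n m by (intro N.m_closed N.inv_op_closed2) auto
  finally have "p \<otimes>\<^bsub>\<F> P\<^esub> h \<otimes>\<^bsub>\<F> P\<^esub> (inv\<^bsub>\<F> P\<^esub> r \<otimes>\<^bsub>\<F> P\<^esub> s) \<otimes>\<^bsub>\<F> P\<^esub> inv\<^bsub>\<F> P\<^esub> k \<otimes>\<^bsub>\<F> P\<^esub> inv\<^bsub>\<F> P\<^esub> q \<in> N" .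
  moreover have "inv\<^bsub>\<F> P\<^esub> k \<in> H"
    using m(2) subgroup.m_inv_closed[OF subgroup_H_subgroup] by blast
  then have "p \<otimes>\<^bsub>\<F> P\<^esub> h \<otimes>\<^bsub>\<F> P\<^esub> (inv\<^bsub>\<F> P\<^esub> r \<otimes>\<^bsub>\<F> P\<^esub> s) \<otimes>\<^bsub>\<F> P\<^esub> inv\<^bsub>\<F> P\<^esub> k \<otimes>\<^bsub>\<F> P\<^esub> inv\<^bsub>\<F> P\<^esub> q \<in> {p} <#>\<^bsub>\<F> P\<^esub> H <#>\<^bsub>\<F> P\<^esub> {inv\<^bsub>\<F> P\<^esub> r \<otimes>\<^bsub>\<F> P\<^esub> s} <#>\<^bsub>\<F> P\<^esub> H <#>\<^bsub>\<F> P\<^esub> {inv\<^bsub>\<F> P\<^esub> q}"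
    by (intro set_multI singletonI n(2))
  moreover have "N \<inter> ({p} <#>\<^bsub>\<F> P\<^esub> H <#>\<^bsub>\<F> P\<^esub> {inv\<^bsub>\<F> P\<^esub> r \<otimes>\<^bsub>\<F> P\<^esub> s} <#>\<^bsub>\<F> P\<^esub> H <#>\<^bsub>\<F> P\<^esub> {inv\<^bsub>\<F> P\<^esub> q}) = {}"
    using assms(1)[unfolded cond_C1_def, rule_format, OF pq rs] \<open>t \<noteq> t'\<close> t t' by simp
  ultimately show False by blast
qed

text \<open>From \<open>p = q n h\<close> it follows that \<open>p h^-1 q^-1\<close> is the
  conjugate \<open>q n q^-1\<close>, hence in \<open>N\<close>, which (C2) excludes.\<close>

lemma vertex_letters_distinct:
  assumes "cond_C2 a0 P N" "p \<in> letters_to P a0 a" "q \<in> letters_to P a0 b" "a \<noteq> b"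
  shows "vertex p \<noteq> vertex q"
proof
  assume "vertex p = vertex q"
  note [simp] = letters_to_carrier[OF assms(2)] letters_to_carrier[OF assms(3)]
  obtain n h where n: "n \<in> N" "h \<in> H" and p: "p = q \<otimes>\<^bsub>\<F> P\<^esub> n \<otimes>\<^bsub>\<F> P\<^esub> h"
    by (rule vertex_eqE[OF \<open>vertex p = vertex q\<close>[symmetric]]) auto
  note [simp] = n(1)[THEN N.mem_carrier] n(2)[THEN H_carrier]
  have "p \<otimes>\<^bsub>\<F> P\<^esub> inv\<^bsub>\<F> P\<^esub> h \<otimes>\<^bsub>\<F> P\<^esub> inv\<^bsub>\<F> P\<^esub> q = q \<otimes>\<^bsub>\<F> P\<^esub> n \<otimes>\<^bsub>\<F> P\<^esub> inv\<^bsub>\<F> P\<^esub> q"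
    unfolding p by (simp add: F.m_assoc)
  also have "\<dots> \<in> N" using n by (intro N.inv_op_closed2) auto
  finally have "p \<otimes>\<^bsub>\<F> P\<^esub> inv\<^bsub>\<F> P\<^esub> h \<otimes>\<^bsub>\<F> P\<^esub> inv\<^bsub>\<F> P\<^esub> q \<in> N" .
  moreover have "inv\<^bsub>\<F> P\<^esub> h \<in> H"
    using n(2) subgroup.m_inv_closed[OF subgroup_H_subgroup] by blast
  then have "p \<otimes>\<^bsub>\<F> P\<^esub> inv\<^bsub>\<F> P\<^esub> h \<otimes>\<^bsub>\<F> P\<^esub> inv\<^bsub>\<F> P\<^esub> q \<in> {p} <#>\<^bsub>\<F> P\<^esub> H <#>\<^bsub>\<F> P\<^esub> {inv\<^bsub>\<F> P\<^esub> q}"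
    by (intro set_multI singletonI n(2))
  moreover have "N \<inter> ({p} <#>\<^bsub>\<F> P\<^esub> H <#>\<^bsub>\<F> P\<^esub> {inv\<^bsub>\<F> P\<^esub> q}) = {}"
    by (rule assms(1)[unfolded cond_C2_def, rule_format, OF assms(2-4)])
  ultimately show False by blast
qed

lemma vertex_letters_eq:
  assumes "p \<in> letters_to P a0 a" "q \<in> letters_to P a0 a"
  shows "vertex p = vertex q"
proof -
  obtain u where u: "u \<in> lists P" "p = word_class P u" "(a0, a) \<in> word_map u"
    using assms(1) by (rule letters_to_word)
  obtain v where v: "v \<in> lists P" "q = word_class P v" "(a0, a) \<in> word_map v"
    using assms(2) by (rule letters_to_word)
  show ?thesis
    unfolding u(2) v(2) by (rule vertex_word_eq) fact+
qed

lemma dist_letters: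
  assumes "cond_C1 d a0 P N" "cond_C2 a0 P N"
    and "pseudometric (Gam a0 P N) \<rho>" "consistent_with_weight d a0 P N \<rho>"
    and "p \<in> letters_to P a0 a" "q \<in> letters_to P a0 b"
  shows "\<rho> (vertex p) (vertex q) = d a b"
\<comment> \<open>For \<open>a = b\<close> the two vertices coincide and no edge joins them, so the
  value comes from zero self-distance and not from consistency.\<close>
proof (cases "a = b")
  case True
  then have "vertex p = vertex q" using assms(5,6) vertex_letters_eq by blast
  moreover have "\<rho> (vertex q) (vertex q) = 0"
    using assms(6) letters_to_carrier
    by (intro pseudometric_on.self_dist[OF pseudometric_on.intro[OF assms(3)]] vertex_Gam)
  ultimately show ?thesis
    using True letters_to_mem[OF assms(5)] by simp
next
  case False
  then have "vertex p \<noteq> vertex q"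
    using vertex_letters_distinct[OF assms(2,5,6)] by simp
  \<comment> \<open>The edge is the one with \<open>g = 1\<close>. Its ends are distinct by (C2),
    and (C1) then makes its weight unique.\<close>
  then have edge: "edge_with_weight d a0 P N (vertex p) (vertex q) (d a b)"
    unfolding edge_with_weight_def
    using letters_to_carrier[OF assms(5)] letters_to_carrier[OF assms(6)]
    by (intro bexI[OF _ F.one_closed] exI[of _ a] exI[of _ b] bexI[OF _ assms(5)]
        bexI[OF _ assms(6)] conjI) simp_all
  have "weight d a0 P N (vertex p) (vertex q) = d a b"
    unfolding weight_def
    by (rule the_equality, rule edge) (rule edge_weight_unique[OF assms(1) _ edge])
  then show ?thesis
    using assms(4) edge unfolding consistent_with_weight_def is_edge_def by metis
qed

lemma extension_of_isomorphic:
  assumes C: "cond_C1 d a0 P N" "cond_C2 a0 P N"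
    and \<rho>: "pseudometric (Gam a0 P N) \<rho>"
      "invariant_under (Phi a0 P N ` carrier (\<F> P)) (Gam a0 P N) \<rho>"
      "consistent_with_weight d a0 P N \<rho>"
    and iso: "isomorphic_pairs P Y e \<phi>
      (metric_ident (Gam a0 P N) \<rho>) (ident_dist \<rho>) (Phi_bar a0 P N \<rho>)"
    and pair: "isometry_pair P Y e \<phi>"
    and finite: "finite (rcosets\<^bsub>\<F> P\<^esub> N)"
  shows "finite Y \<and> (\<exists>\<iota>. S_extension X d P Y e \<phi> \<iota> \<and> minimal_extension a0 P Y e \<phi> \<iota>)"
proof -
  let ?\<Gamma> = "Gam a0 P N"
  interpret Q: pseudometric_on ?\<Gamma> \<rho> by unfold_locales (rule \<rho>(1))
  interpret A: converse_hom P "iso_group Y e" \<phi>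
    by (rule isometry_pair_converse_hom[OF converse_image pair])
  from iso obtain \<pi> where \<pi>: "bij_betw \<pi> Y (metric_ident ?\<Gamma> \<rho>)"
    and \<pi>_dist: "\<And>x y. \<lbrakk>x \<in> Y; y \<in> Y\<rbrakk> \<Longrightarrow> ident_dist \<rho> (\<pi> x) (\<pi> y) = e x y"
    and \<pi>_act: "\<And>p y. \<lbrakk>p \<in> P; y \<in> Y\<rbrakk> \<Longrightarrow> Phi_bar a0 P N \<rho> p (\<pi> y) = \<pi> (\<phi> p y)"
    unfolding isomorphic_pairs_def by blast
  have inj: "\<lbrakk>x \<in> Y; y \<in> Y; \<pi> x = \<pi> y\<rbrakk> \<Longrightarrow> x = y" for x y
    using \<pi> by (auto simp: bij_betw_def dest: inj_onD)
  \<comment> \<open>On classes a letter acts as left multiplication of the representing group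
    element; invariance of \<open>\<rho>\<close> makes this well defined.\<close>
  have Phi_bar: "Phi_bar a0 P N \<rho> p (Q.point_class (vertex g))
      = Q.point_class (vertex (word_class P [p] \<otimes>\<^bsub>\<F> P\<^esub> g))"
    if p: "p \<in> P" and g: "g \<in> carrier (\<F> P)" for p g
  proof -
    have p': "word_class P [p] \<in> carrier (\<F> P)" using p by simp
    have "Phi_bar a0 P N \<rho> p (Q.point_class (vertex g))
        = Q.point_class (Phi a0 P N (word_class P [p]) (vertex g))"
      unfolding Phi_bar_def
    proof (rule Q.ident_map_point_class)
      show "Phi a0 P N (word_class P [p]) \<in> ?\<Gamma> \<rightarrow> ?\<Gamma>"
        using p' by (auto simp: Gam_image Phi_vertex)
      show "\<rho> (Phi a0 P N (word_class P [p]) A) (Phi a0 P N (word_class P [p]) B) = \<rho> A B"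
        if "A \<in> ?\<Gamma>" "B \<in> ?\<Gamma>" for A B
        using \<rho>(2) that p' by (auto simp: invariant_under_def)
    qed (use g in simp)
    then show ?thesis using p' g by (simp add: Phi_vertex)
  qed
  \<comment> \<open>The same for words, carried over to \<open>Y\<close>. It serves to reach every
    point of \<open>Y\<close> from the base point.\<close>
  have \<pi>_word: "A.eval_word w y \<in> Y \<and>
      \<pi> (A.eval_word w y) = Q.point_class (vertex (word_class P w \<otimes>\<^bsub>\<F> P\<^esub> g))"
    if "w \<in> lists P" "g \<in> carrier (\<F> P)" "y \<in> Y" "\<pi> y = Q.point_class (vertex g)" for w g y
    using that(1)
  proof (induction w)
    case Nil
    with that show ?case by (simp add: iso_group_one flip: one_free_group)
  next
    case (Cons p w)
    then have p: "p \<in> P" and w: "w \<in> lists P"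
      and IH: "A.eval_word w y \<in> Y"
        "\<pi> (A.eval_word w y) = Q.point_class (vertex (word_class P w \<otimes>\<^bsub>\<F> P\<^esub> g))"
      by auto
    have pw: "word_class P (p # w) \<otimes>\<^bsub>\<F> P\<^esub> g = word_class P [p] \<otimes>\<^bsub>\<F> P\<^esub> (word_class P w \<otimes>\<^bsub>\<F> P\<^esub> g)"
      using p w that(2) by (simp flip: F.m_assoc)
    have step: "A.eval_word (p # w) y = \<phi> p (A.eval_word w y)"
      using p w that(3) by (simp add: iso_group_mult)
    have "\<pi> (\<phi> p (A.eval_word w y)) = Q.point_class (vertex (word_class P (p # w) \<otimes>\<^bsub>\<F> P\<^esub> g))"
      unfolding pw \<pi>_act[OF p IH(1), symmetric] IH(2) using p w that(2) by (intro Phi_bar) auto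
    moreover have "\<phi> p (A.eval_word w y) \<in> Y"
      using p IH(1) iso_group_closed[OF A.gen_carrier] by blast
    ultimately show ?case unfolding step by blast
  qed
  \<comment> \<open>Some element of \<open>P \<union> {1}\<close> sending \<open>a0\<close> to
    \<open>a\<close>; its vertex does not depend on the choice.\<close>
  define letter where "letter a = (SOME x. x \<in> letters_to P a0 a)" for a
  have letter: "letter a \<in> letters_to P a0 a" if "a \<in> X" for a
    unfolding letter_def using letters_to_nonempty[OF that] by (rule someI_ex)
  have letter_carrier: "letter a \<in> carrier (\<F> P)" if "a \<in> X" for a
    using letters_to_carrier[OF letter[OF that]] .
  \<comment> \<open>The standard embedding of \<open>X\<close> into the metric identification,
    pulled back along \<open>\<pi>\<close>.\<close>
  define \<iota> where "\<iota> a = inv_into Y \<pi> (Q.point_class (vertex (letter a)))" for a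
  have range: "Q.point_class (vertex g) \<in> \<pi> ` Y" if "g \<in> carrier (\<F> P)" for g
    using \<pi> that by (simp add: bij_betw_def Q.metric_ident_image)
  have \<iota>: "\<iota> a \<in> Y" "\<pi> (\<iota> a) = Q.point_class (vertex (letter a))" if "a \<in> X" for a
    using inv_into_into[OF range[OF letter_carrier[OF that]]]
      f_inv_into_f[OF range[OF letter_carrier[OF that]]] by (simp_all add: \<iota>_def)
  have "e (\<iota> a) (\<iota> b) = d a b" if "a \<in> X" "b \<in> X" for a b
  proof -
    have "e (\<iota> a) (\<iota> b) = \<rho> (vertex (letter a)) (vertex (letter b))"
      using that \<pi>_dist[of "\<iota> a" "\<iota> b"] \<iota> letter_carrier by simp
    also have "\<dots> = d a b"
      using that letter by (intro dist_letters C \<rho>)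
    finally show ?thesis .
  qed
  moreover have "\<phi> p (\<iota> x) = \<iota> y" if p: "p \<in> P" "(x, y) \<in> p" for p x y
  proof -
    from p letter_subset have xy: "x \<in> X" "y \<in> X" by auto
    obtain u where u: "u \<in> lists P" "letter x = word_class P u" "(a0, x) \<in> word_map u"
      using letter[OF xy(1)] by (rule letters_to_word)
    obtain v where v: "v \<in> lists P" "letter y = word_class P v" "(a0, y) \<in> word_map v"
      using letter[OF xy(2)] by (rule letters_to_word)
    have "\<pi> (\<phi> p (\<iota> x)) = Q.point_class (vertex (word_class P (p # u)))"
      using p \<iota>[OF xy(1)] letter_carrier[OF xy(1)] u(1,2) by (simp add: Phi_bar flip: \<pi>_act)
    \<comment> \<open>The word \<open>p # u\<close> sends \<open>a0\<close> through \<open>x\<close>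
      to \<open>y\<close>, so its vertex is that of \<open>letter y\<close>.\<close>
    also have "vertex (word_class P (p # u)) = vertex (letter y)"
      unfolding v(2) using u v p by (intro vertex_word_eq) auto
    finally show ?thesis
      using \<iota>[OF xy(2)] \<iota>(1)[OF xy(1)] p(1) iso_group_closed[OF A.gen_carrier] inj by metis
  qed
  ultimately have "S_extension X d P Y e \<phi> \<iota>"
    unfolding S_extension_def using pair \<iota>(1) by auto
  moreover have "minimal_extension a0 P Y e \<phi> \<iota>"
    unfolding minimal_extension_def
  proof
    fix y assume "y \<in> Y"
    then have "\<pi> y \<in> Q.point_class ` ?\<Gamma>" using \<pi> by (auto simp: bij_betw_def Q.metric_ident_image)
    then obtain w where w: "w \<in> lists P" "\<pi> y = Q.point_class (vertex (word_class P w))"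
      by (auto simp: Gam_image carrier_free_group)
    have one: "\<one>\<^bsub>\<F> P\<^esub> \<in> letters_to P a0 a0" by (simp add: letters_to_def)
    \<comment> \<open>\<open>letter a0\<close> need not be the identity, but both give the same
      vertex.\<close>
    have "\<pi> (\<iota> a0) = Q.point_class (vertex \<one>\<^bsub>\<F> P\<^esub>)"
      using \<iota>(2)[OF base_point] vertex_letters_eq[OF letter[OF base_point] one] by simp
    from \<pi>_word[OF w(1) F.one_closed \<iota>(1)[OF base_point] this] w \<open>y \<in> Y\<close>
    have "y = A.eval_word w (\<iota> a0)"
      by (intro inj) auto
    then show "\<exists>g\<in>carrier (\<F> P). y = hom_extension (iso_group Y e) \<phi> g (\<iota> a0)"
      using w(1) by (intro bexI[of _ "word_class P w"]) auto
  qed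
  \<comment> \<open>\<open>Y\<close> is in bijection with a quotient of the finite set
    \<open>Gam a0 P N\<close>.\<close>
  moreover have "finite Y"
    using bij_betw_finite[OF \<pi>] finite_Gam[OF finite] by (simp add: Q.metric_ident_image)
  ultimately show ?thesis by blast
qed

end

section \<open>Equivalence of the three descriptions of finite minimal S-extensions\<close>

theorem theorem4p7:
  fixes X :: "'a set" and d :: "'a \<Rightarrow> 'a \<Rightarrow> real" and a0 :: 'a and P :: "'a pmap set"
    and Y :: "'b set" and e :: "'b \<Rightarrow> 'b \<Rightarrow> real" and \<phi> :: "'a pmap \<Rightarrow> 'b \<Rightarrow> 'b"
  assumes "Metric_space X d" and "finite X" and "a0 \<in> X"
    and "P \<subseteq> nontrivial_partial_isometries X d"
    and "converse ` P = P"
    and "X - {a0} \<subseteq> values_at P a0"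
    and "isometry_pair P Y e \<phi>"
  defines "K \<equiv> kernel (\<F> P) (iso_group Y e) (hom_extension (iso_group Y e) \<phi>)"
  defines "cond_i \<equiv> finite Y \<and> (\<exists>\<iota>. S_extension X d P Y e \<phi> \<iota> \<and> minimal_extension a0 P Y e \<phi> \<iota>)"
  defines "cond_ii \<equiv> (\<exists>N. N \<lhd> \<F> P \<and> finite (rcosets\<^bsub>\<F> P\<^esub> N) \<and>
        cond_C1 d a0 P N \<and> cond_C2 a0 P N \<and> cond_C3 d a0 P N \<and>
        (\<exists>\<rho>. pseudometric (Gam a0 P N) \<rho> \<and>
             invariant_under (Phi a0 P N ` carrier (\<F> P)) (Gam a0 P N) \<rho> \<and>
             consistent_with_weight d a0 P N \<rho> \<and>
             isomorphic_pairs P Y e \<phi>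
               (metric_ident (Gam a0 P N) \<rho>) (ident_dist \<rho>) (Phi_bar a0 P N \<rho>)))"
  defines "cond_iii \<equiv> finite (rcosets\<^bsub>\<F> P\<^esub> K) \<and>
        cond_C1 d a0 P K \<and> cond_C2 a0 P K \<and> cond_C3 d a0 P K \<and>
        (\<exists>\<rho>. pseudometric (Gam a0 P K) \<rho> \<and>
             invariant_under (Phi a0 P K ` carrier (\<F> P)) (Gam a0 P K) \<rho> \<and>
             consistent_with_weight d a0 P K \<rho> \<and>
             isomorphic_pairs P Y e \<phi>
               (metric_ident (Gam a0 P K) \<rho>) (ident_dist \<rho>) (Phi_bar a0 P K \<rho>))"
  shows "(cond_i \<longleftrightarrow> cond_ii) \<and> (cond_ii \<longleftrightarrow> cond_iii)"
proof -
  interpret pointed_partial_isometries P X d a0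
    using assms(1,3-6)
    by (simp add: pointed_partial_isometries_def pointed_partial_isometries_axioms_def
        converse_closed_def)
  interpret A: converse_hom P "iso_group Y e" \<phi>
    by (rule isometry_pair_converse_hom[OF assms(5,7)])
  \<comment> \<open>The implications are closed in the order (i), (iii), (ii), (i).\<close>
  have "cond_i \<Longrightarrow> cond_iii"
  proof -
    assume cond_i
    then obtain \<iota> where "finite Y" "S_extension X d P Y e \<phi> \<iota>"
      and minimal: "minimal_extension a0 P Y e \<phi> \<iota>"
      unfolding cond_i_def by blast
    then interpret E: pointed_extension P X d a0 Y e \<phi> \<iota>
      by unfold_locales
    \<comment> \<open>A finite \<open>Y\<close> has only finitely many isometries, so the kernel has
      finite index.\<close>
    have "finite (rcosets\<^bsub>\<F> P\<^esub> K)"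
      unfolding K_def by (rule A.ext.finite_rcosets_kernel[OF finite_iso_group[OF \<open>finite Y\<close>]])
    then show cond_iii
      unfolding cond_iii_def K_def
      using E.cond_C1_kernel E.cond_C2_kernel E.cond_C3_kernel E.pseudometric_pulled_dist
        E.invariant_pulled_dist E.consistent_pulled_dist E.isomorphic_pulled_dist[OF minimal]
      by blast
  qed
  moreover have "cond_iii \<Longrightarrow> cond_ii"
    unfolding cond_ii_def cond_iii_def using A.ext.normal_kernel unfolding K_def by blast
  moreover have "cond_ii \<Longrightarrow> cond_i"
  proof -
    assume cond_ii
    then obtain N \<rho> where N: "N \<lhd> \<F> P" "finite (rcosets\<^bsub>\<F> P\<^esub> N)" "cond_C1 d a0 P N" "cond_C2 a0 P N"
      and \<rho>: "pseudometric (Gam a0 P N) \<rho>"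
        "invariant_under (Phi a0 P N ` carrier (\<F> P)) (Gam a0 P N) \<rho>"
        "consistent_with_weight d a0 P N \<rho>"
        "isomorphic_pairs P Y e \<phi> (metric_ident (Gam a0 P N) \<rho>) (ident_dist \<rho>) (Phi_bar a0 P N \<rho>)"
      unfolding cond_ii_def by blast
    interpret normal_word_subgroup P X d a0 N
      by (intro normal_word_subgroup.intro pointed_partial_isometries_axioms N(1))
    show cond_i
      unfolding cond_i_def by (rule extension_of_isomorphic[OF N(3,4) \<rho> assms(7) N(2)])
  qed
  ultimately show ?thesis by blast
qed

end
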